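(* Let $\mathbf{H} \in C^1((0,T); \mathbf{H}_{\#}(\mathbf{curl}; \Omega))$ and $\mathbf{J} \in C^1((0,T); \mathbf{H}_{\#}(\mathbf{curl};\Omega))$ be a solution of the system $$\partial_{tt} \mathbf{H} + c^2\, \mathbf{curl}\,\mathbf{curl}\, \mathbf{H} + \omega_{pm}^2 \mathbf{H} = c^2\, \mathbf{curl}\, \mathbf{J}, \qquad \partial_{tt} \mathbf{J} + \omega_{pe}^2 \mathbf{J} = \omega_{pe}^2\, \mathbf{curl}\, \mathbf{H}.$$ Then $$\frac{d\mathcal{E}_{HJ}}{dt} = 0,$$ where $$\mathcal{E}_{HJ} = \frac{1}{2}\Bigl( \frac{1}{c^2}\|\partial_t \mathbf{H}\|^2 + \frac{1}{\omega_{pe}^2}\|\partial_t \mathbf{J}\|^2 + \frac{\omega_{pm}^2}{c^2}\|\mathbf{H}\|^2 + \|\mathbf{curl}\, \mathbf{H} - \mathbf{J}\|^2 \Bigr).$$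
   Context: $\Omega = [0,L]^3$ is a cube, $T>0$. The constants $\varepsilon_0,\mu_0,\omega_{pe},\omega_{pm}$ are positive and $c = 1/\sqrt{\varepsilon_0\mu_0}$. $\|\cdot\|$ denotes the $L^2$ norm on $\Omega$. The function space is $$\mathbf{H}_{\#}(\mathbf{curl};\Omega) := \{\mathbf{v}\in (L^2(\Omega))^3 : \mathbf{curl}\,\mathbf{v}\in (L^2(\Omega))^3,\ \mathbf{v}\text{ periodic on }\partial\Omega\}.$$ The system is the second order formulation (for the magnetic field $\mathbf{H}$ and the polarization current density $\mathbf{J}$) of Maxwell's equations in a Drude metamaterial. *)

theory Defs
  imports "HOL-Analysis.Analysis"
begin

type_synonym field = "real^3 \<Rightarrow> real^3"

definition cube :: "real \<Rightarrow> (real^3) set" where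
  "cube L = cbox 0 (\<chi> i. L)"


subsection \<open>Square integrable fields on the cube\<close>

text \<open>Fields are represented by functions on the whole space; only their values almost
  everywhere on the cube enter the notions below, except for test fields.\<close>

definition L2_field :: "real \<Rightarrow> field \<Rightarrow> bool" where
  "L2_field L v \<longleftrightarrow> v \<in> borel_measurable (lebesgue_on (cube L)) \<and>
     integrable (lebesgue_on (cube L)) (\<lambda>x. (norm (v x))\<^sup>2)"

definition L2_inner :: "real \<Rightarrow> field \<Rightarrow> field \<Rightarrow> real" where
  "L2_inner L u v = (LINT x|lebesgue_on (cube L). u x \<bullet> v x)"

definition L2_norm :: "real \<Rightarrow> field \<Rightarrow> real" where
  "L2_norm L v = sqrt (LINT x|lebesgue_on (cube L). (norm (v x))\<^sup>2)"


subsection \<open>Smooth test fields\<close>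

definition partial :: "3 \<Rightarrow> field \<Rightarrow> field" where
  "partial i f x = frechet_derivative f (at x) (axis i 1)"

primrec C_k_field :: "nat \<Rightarrow> field \<Rightarrow> bool" where
  "C_k_field 0 f \<longleftrightarrow> continuous_on UNIV f"
| "C_k_field (Suc k) f \<longleftrightarrow> f differentiable_on UNIV \<and> (\<forall>i. C_k_field k (partial i f))"

definition smooth_field :: "field \<Rightarrow> bool" where
  "smooth_field f \<longleftrightarrow> (\<forall>k. C_k_field k f)"

definition curl :: "field \<Rightarrow> field" where
  "curl f x = vector
     [partial 2 f x $ 3 - partial 3 f x $ 2,
      partial 3 f x $ 1 - partial 1 f x $ 3,
      partial 1 f x $ 2 - partial 2 f x $ 1]"

definition interior_test :: "real \<Rightarrow> field set" where
  "interior_test L = {\<phi>. smooth_field \<phi> \<and>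
     (\<exists>K. compact K \<and> K \<subseteq> interior (cube L) \<and> (\<forall>x. x \<notin> K \<longrightarrow> \<phi> x = 0))}"

definition periodic_test :: "real \<Rightarrow> field set" where
  "periodic_test L = {\<phi>. smooth_field \<phi> \<and> (\<forall>x i. \<phi> (x + L *\<^sub>R axis i 1) = \<phi> x)}"


subsection \<open>The periodic curl space\<close>

definition has_weak_curl :: "real \<Rightarrow> field \<Rightarrow> field \<Rightarrow> bool" where
  "has_weak_curl L v w \<longleftrightarrow> L2_field L v \<and> L2_field L w \<and>
     (\<forall>\<phi>\<in>interior_test L. L2_inner L v (curl \<phi>) = L2_inner L w \<phi>)"

text \<open>The weak curl is unique up to a null set; \<open>wcurl\<close> picks a representative.\<close>

definition wcurl :: "real \<Rightarrow> field \<Rightarrow> field" where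
  "wcurl L v = (SOME w. has_weak_curl L v w)"

text \<open>A field with square integrable curl has only a tangential trace on the boundary. It is
  defined through Green's formula: with the outer normal \<open>n\<close>, the pairing of \<open>n \<times> v\<close> with a
  smooth \<open>\<phi>\<close> is \<open>\<integral> curl v \<bullet> \<phi> - v \<bullet> curl \<phi>\<close>. When \<open>\<phi>\<close> is periodic, opposite faces
  (which have opposite normals) contribute the difference of the two traces, so the traces on
  opposite faces agree iff the pairing vanishes for every periodic \<open>\<phi>\<close>.\<close>

definition periodic_trace :: "real \<Rightarrow> field \<Rightarrow> bool" where
  "periodic_trace L v \<longleftrightarrow>
     (\<forall>\<phi>\<in>periodic_test L. L2_inner L (wcurl L v) \<phi> - L2_inner L v (curl \<phi>) = 0)"

definition Hcurl_per :: "real \<Rightarrow> field set" where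
  "Hcurl_per L = {v. (\<exists>w. has_weak_curl L v w) \<and> periodic_trace L v}"

definition Hcurl_norm :: "real \<Rightarrow> field \<Rightarrow> real" where
  "Hcurl_norm L v = sqrt ((L2_norm L v)\<^sup>2 + (L2_norm L (wcurl L v))\<^sup>2)"

text \<open>\<open>C1_Hcurl_per L T u ut\<close>: the curve \<open>u\<close> is continuously differentiable on \<open>(0,T)\<close> with
  values in the periodic curl space, and its time derivative is \<open>ut\<close>.\<close>

definition C1_Hcurl_per ::
  "real \<Rightarrow> real \<Rightarrow> (real \<Rightarrow> field) \<Rightarrow> (real \<Rightarrow> field) \<Rightarrow> bool" where
  "C1_Hcurl_per L T u ut \<longleftrightarrow>
     (\<forall>t\<in>{0<..<T}. u t \<in> Hcurl_per L \<and> ut t \<in> Hcurl_per L \<and>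
        ((\<lambda>s. Hcurl_norm L (\<lambda>x. (u s x - u t x) /\<^sub>R (s - t) - ut t x)) \<longlongrightarrow> 0) (at t) \<and>
        ((\<lambda>s. Hcurl_norm L (\<lambda>x. ut s x - ut t x)) \<longlongrightarrow> 0) (at t))"


subsection \<open>The second order system\<close>

text \<open>For curves that are only \<open>C\<^sup>1\<close> in time with values in the curl space, the second time
  derivatives and \<open>curl curl H\<close> need not be functions. They are periodic distributions, that is,
  functionals on the smooth periodic test fields, and the equations are identities between such
  functionals at every time. In three dimensions the transpose of the curl is the curl.\<close>

definition dist_of :: "real \<Rightarrow> field \<Rightarrow> (field \<Rightarrow> real)" where
  "dist_of L v = (\<lambda>\<phi>. L2_inner L v \<phi>)"

definition dist_curl :: "(field \<Rightarrow> real) \<Rightarrow> (field \<Rightarrow> real)" where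
  "dist_curl D = (\<lambda>\<phi>. D (curl \<phi>))"

definition has_dist_derivative ::
  "real \<Rightarrow> (real \<Rightarrow> field \<Rightarrow> real) \<Rightarrow> (field \<Rightarrow> real) \<Rightarrow> real \<Rightarrow> bool" where
  "has_dist_derivative L D D' t \<longleftrightarrow>
     (\<forall>\<phi>\<in>periodic_test L. ((\<lambda>s. D s \<phi>) has_real_derivative D' \<phi>) (at t))"

definition drude_solution ::
  "real \<Rightarrow> real \<Rightarrow> real \<Rightarrow> real \<Rightarrow> real \<Rightarrow>
   (real \<Rightarrow> field) \<Rightarrow> (real \<Rightarrow> field) \<Rightarrow> (real \<Rightarrow> field) \<Rightarrow> (real \<Rightarrow> field) \<Rightarrow> bool" where
  "drude_solution L T c \<omega>pe \<omega>pm H Ht J Jt \<longleftrightarrow>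
     (\<forall>t\<in>{0<..<T}. \<exists>Htt Jtt.
        has_dist_derivative L (\<lambda>s. dist_of L (Ht s)) Htt t \<and>
        has_dist_derivative L (\<lambda>s. dist_of L (Jt s)) Jtt t \<and>
        (\<forall>\<phi>\<in>periodic_test L.
           Htt \<phi> + c\<^sup>2 * dist_curl (dist_of L (wcurl L (H t))) \<phi> + \<omega>pm\<^sup>2 * dist_of L (H t) \<phi>
             = c\<^sup>2 * dist_of L (wcurl L (J t)) \<phi> \<and>
           Jtt \<phi> + \<omega>pe\<^sup>2 * dist_of L (J t) \<phi> = \<omega>pe\<^sup>2 * dist_of L (wcurl L (H t)) \<phi>))"

definition energy_HJ ::
  "real \<Rightarrow> real \<Rightarrow> real \<Rightarrow> real \<Rightarrow>
   (real \<Rightarrow> field) \<Rightarrow> (real \<Rightarrow> field) \<Rightarrow> (real \<Rightarrow> field) \<Rightarrow> (real \<Rightarrow> field) \<Rightarrow> real \<Rightarrow> real" where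
  "energy_HJ L c \<omega>pe \<omega>pm H Ht J Jt t =
     1 / 2 * (1 / c\<^sup>2 * (L2_norm L (Ht t))\<^sup>2 + 1 / \<omega>pe\<^sup>2 * (L2_norm L (Jt t))\<^sup>2
       + \<omega>pm\<^sup>2 / c\<^sup>2 * (L2_norm L (H t))\<^sup>2
       + (L2_norm L (\<lambda>x. wcurl L (H t) x - J t x))\<^sup>2)"

end

(* The fields with frequencies in a finite set form a finite dimensional space that is invariant under
   the curl and on which the curl is symmetric. The orthogonal projections onto these spaces
   therefore commute with the periodic curl, so trigonometric fields are dense in the periodic curl
   space, and the curl is symmetric there. The equations bound the second time derivatives, which
   are only functionals on test fields, by the norm of the curl space. Density then allows Ht and Jt
   themselves as test fields, the squared norms of Ht and Jt become differentiable, and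
   everything in the derivative of the energy cancels except (curl J, Ht) - (J, curl Ht), which
   vanishes by symmetry. *)

theory Submission
  imports Defs
begin

section \<open>Square integrable fields\<close>

text \<open>Two obstacles shape the proof. Fields are plain functions and \<open>wcurl\<close> picks
  an arbitrary representative, so \<open>wcurl\<close> need not be linear: a difference quotient of
  chosen curls is only almost everywhere the chosen curl of the difference quotient. Weak curls must
  therefore be shown unique, which takes a supply of compactly supported smooth fields; this is
  where the bump functions come from. The other obstacle is that the system differentiates pairings
  with one fixed test field at a time, whereas the energy pairs \<open>Ht s\<close> with itself. By
  |a|^2 - |b|^2 = (a - b, a) + (a - b, b) it is enough to test an increment with its two endpoints,
  but one of these moves with the time, so the error of the difference quotient must be uniform over
  test fields of bounded curl norm. The terms with \<open>H\<close> and with the curl of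
  \<open>H\<close> minus \<open>J\<close> need none of this, because these curves are differentiable
  in L2.\<close>

lemma L2_fieldD:
  assumes "L2_field L v"
  shows "v \<in> borel_measurable (lebesgue_on (cube L))"
    and "integrable (lebesgue_on (cube L)) (\<lambda>x. (norm (v x))\<^sup>2)"
  using assms by (auto simp: L2_field_def)

lemma L2_inner_integrable:
  assumes "L2_field L u" "L2_field L v"
  shows "integrable (lebesgue_on (cube L)) (\<lambda>x. u x \<bullet> v x)"
proof (rule Bochner_Integration.integrable_bound)
  show "integrable (lebesgue_on (cube L)) (\<lambda>x. (norm (u x))\<^sup>2 + (norm (v x))\<^sup>2)"
    using assms by (intro Bochner_Integration.integrable_add L2_fieldD)
  show "(\<lambda>x. u x \<bullet> v x) \<in> borel_measurable (lebesgue_on (cube L))"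
    using assms by (intro borel_measurable_inner L2_fieldD)
  have "norm (u x \<bullet> v x) \<le> norm ((norm (u x))\<^sup>2 + (norm (v x))\<^sup>2)" for x
  proof -
    have "\<bar>u x \<bullet> v x\<bar> \<le> norm (u x) * norm (v x)"
      by (rule Cauchy_Schwarz_ineq2)
    also have "\<dots> \<le> (norm (u x))\<^sup>2 + (norm (v x))\<^sup>2"
    proof -
      have "0 \<le> norm (u x) * norm (v x)" by simp
      then show ?thesis
        using sum_squares_bound[of "norm (u x)" "norm (v x)"] by linarith
    qed
    finally show ?thesis by simp
  qed
  then show "AE x in lebesgue_on (cube L). norm (u x \<bullet> v x) \<le> norm ((norm (u x))\<^sup>2 + (norm (v x))\<^sup>2)"
    by simp
qed

lemma L2_field_add [simp, intro]:
  assumes "L2_field L u" "L2_field L v"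
  shows "L2_field L (\<lambda>x. u x + v x)"
proof -
  have "integrable (lebesgue_on (cube L)) (\<lambda>x. (norm (u x))\<^sup>2 + 2 * (u x \<bullet> v x) + (norm (v x))\<^sup>2)"
    using assms by (intro Bochner_Integration.integrable_add L2_fieldD integrable_mult_right L2_inner_integrable)
  moreover have "(\<lambda>x. (norm (u x + v x))\<^sup>2) = (\<lambda>x. (norm (u x))\<^sup>2 + 2 * (u x \<bullet> v x) + (norm (v x))\<^sup>2)"
    by (simp add: power2_norm_eq_inner inner_add inner_commute algebra_simps)
  ultimately show ?thesis
    using assms by (auto simp: L2_field_def)
qed

lemma L2_field_scaleR [simp, intro]:
  assumes "L2_field L u"
  shows "L2_field L (\<lambda>x. r *\<^sub>R u x)"
  using assms by (auto simp: L2_field_def power_mult_distrib)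

lemma L2_field_diff [simp, intro]:
  assumes "L2_field L u" "L2_field L v"
  shows "L2_field L (\<lambda>x. u x - v x)"
  using L2_field_add[OF assms(1) L2_field_scaleR[OF assms(2), of "-1"]] by simp

lemma L2_field_continuous:
  assumes "continuous_on UNIV v"
  shows "L2_field L v"
  unfolding L2_field_def
proof
  show "v \<in> borel_measurable (lebesgue_on (cube L))"
    using assms by (intro continuous_imp_measurable_on_sets_lebesgue)
      (auto simp: cube_def intro: continuous_on_subset)
  show "integrable (lebesgue_on (cube L)) (\<lambda>x. (norm (v x))\<^sup>2)"
    unfolding cube_def using assms
    by (intro continuous_imp_integrable continuous_intros) (auto intro: continuous_on_subset)
qed

lemma L2_field_zero [simp, intro]: "L2_field L (\<lambda>x. 0)"
  by (rule L2_field_continuous) simp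

text \<open>A continuous factor is bounded on the compact cube. The factors in question are the
  cut-offs \<open>box_bump\<close>.\<close>

lemma L2_field_mult_bounded:
  fixes f :: "real^3 \<Rightarrow> real"
  assumes v: "L2_field L v" and f: "continuous_on UNIV f"
  shows "L2_field L (\<lambda>x. f x *\<^sub>R v x)"
proof -
  have "compact (f ` cube L)"
    unfolding cube_def using f by (intro compact_continuous_image) (auto intro: continuous_on_subset)
  then obtain B where B: "\<And>x. x \<in> cube L \<Longrightarrow> \<bar>f x\<bar> \<le> B"
    by (metis bounded_iff compact_imp_bounded image_eqI real_norm_def)
  have fm: "f \<in> borel_measurable (lebesgue_on (cube L))"
    using f by (intro continuous_imp_measurable_on_sets_lebesgue)
      (auto simp: cube_def intro: continuous_on_subset)
  have m: "(\<lambda>x. f x *\<^sub>R v x) \<in> borel_measurable (lebesgue_on (cube L))"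
    using fm L2_fieldD(1)[OF v] by simp
  have "integrable (lebesgue_on (cube L)) (\<lambda>x. (norm (f x *\<^sub>R v x))\<^sup>2)"
  proof (rule Bochner_Integration.integrable_bound)
    show "integrable (lebesgue_on (cube L)) (\<lambda>x. B\<^sup>2 * (norm (v x))\<^sup>2)"
      using v by (intro integrable_mult_right L2_fieldD)
    show "(\<lambda>x. (norm (f x *\<^sub>R v x))\<^sup>2) \<in> borel_measurable (lebesgue_on (cube L))"
      using borel_measurable_power[OF measurable_compose[OF m borel_measurable_norm]] .
    show "AE x in lebesgue_on (cube L). norm ((norm (f x *\<^sub>R v x))\<^sup>2) \<le> norm (B\<^sup>2 * (norm (v x))\<^sup>2)"
    proof (rule AE_I2)
      fix x assume "x \<in> space (lebesgue_on (cube L))"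
      then have "\<bar>f x\<bar>\<^sup>2 \<le> B\<^sup>2"
        using B by (intro power_mono) auto
      then show "norm ((norm (f x *\<^sub>R v x))\<^sup>2) \<le> norm (B\<^sup>2 * (norm (v x))\<^sup>2)"
        by (simp add: power_mult_distrib mult_right_mono)
    qed
  qed
  with m show ?thesis by (simp add: L2_field_def)
qed

lemma L2_inner_commute: "L2_inner L u v = L2_inner L v u"
  by (simp add: L2_inner_def inner_commute)

lemma L2_inner_add_left:
  assumes "L2_field L u" "L2_field L v" "L2_field L w"
  shows "L2_inner L (\<lambda>x. u x + v x) w = L2_inner L u w + L2_inner L v w"
  using assms by (simp add: L2_inner_def inner_add_left L2_inner_integrable)

lemma L2_inner_diff_left:
  assumes "L2_field L u" "L2_field L v" "L2_field L w"
  shows "L2_inner L (\<lambda>x. u x - v x) w = L2_inner L u w - L2_inner L v w"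
  using assms by (simp add: L2_inner_def inner_diff_left L2_inner_integrable)

lemma L2_inner_scaleR_left: "L2_inner L (\<lambda>x. r *\<^sub>R u x) w = r * L2_inner L u w"
  by (simp add: L2_inner_def)

lemma L2_inner_add_right:
  assumes "L2_field L u" "L2_field L v" "L2_field L w"
  shows "L2_inner L w (\<lambda>x. u x + v x) = L2_inner L w u + L2_inner L w v"
  using assms by (simp add: L2_inner_def inner_add_right L2_inner_integrable)

lemma L2_inner_diff_right:
  assumes "L2_field L u" "L2_field L v" "L2_field L w"
  shows "L2_inner L w (\<lambda>x. u x - v x) = L2_inner L w u - L2_inner L w v"
  using assms by (simp add: L2_inner_def inner_diff_right L2_inner_integrable)

lemma L2_inner_scaleR_right: "L2_inner L w (\<lambda>x. r *\<^sub>R u x) = r * L2_inner L w u"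
  by (simp add: L2_inner_def)

lemmas L2_inner_linear = L2_inner_add_left L2_inner_diff_left L2_inner_scaleR_left
  L2_inner_add_right L2_inner_diff_right L2_inner_scaleR_right

lemma L2_inner_zero [simp]: "L2_inner L (\<lambda>x. 0) v = 0" "L2_inner L v (\<lambda>x. 0) = 0"
  by (simp_all add: L2_inner_def)

lemma L2_norm_zero [simp]: "L2_norm L (\<lambda>x. 0) = 0"
  by (simp add: L2_norm_def)

lemma L2_norm_nonneg [simp]: "L2_norm L v \<ge> 0"
  by (simp add: L2_norm_def)

lemma L2_norm_sq: "(L2_norm L v)\<^sup>2 = L2_inner L v v"
  by (simp add: L2_norm_def L2_inner_def power2_norm_eq_inner)

lemma L2_norm_scaleR: "L2_norm L (\<lambda>x. r *\<^sub>R v x) = \<bar>r\<bar> * L2_norm L v"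
  by (simp add: L2_norm_def power_mult_distrib real_sqrt_mult)

lemma L2_norm_minus_commute: "L2_norm L (\<lambda>x. u x - v x) = L2_norm L (\<lambda>x. v x - u x)"
  by (simp add: L2_norm_def norm_minus_commute)

text \<open>Fields that agree almost everywhere are not identified, so the form is only
  semidefinite, and a \<open>v\<close> of norm zero needs a case of its own.\<close>

lemma L2_Cauchy_Schwarz:
  assumes u: "L2_field L u" and v: "L2_field L v"
  shows "\<bar>L2_inner L u v\<bar> \<le> L2_norm L u * L2_norm L v"
proof -
  define a b d where "a = L2_inner L u u" and "b = L2_inner L u v" and "d = L2_inner L v v"
  have nn: "a \<ge> 0" "d \<ge> 0"
    by (simp_all add: a_def d_def flip: L2_norm_sq)
  have q: "a - 2 * r * b + r\<^sup>2 * d \<ge> 0" for r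
  proof -
    have "0 \<le> L2_inner L (\<lambda>x. u x - r *\<^sub>R v x) (\<lambda>x. u x - r *\<^sub>R v x)"
      by (simp flip: L2_norm_sq)
    also have "\<dots> = a - 2 * r * b + r\<^sup>2 * d"
      using u v by (simp add: L2_inner_linear L2_inner_commute[of L v u] a_def b_def d_def
          power2_eq_square algebra_simps)
    finally show ?thesis .
  qed
  have "b\<^sup>2 \<le> a * d"
  proof (cases "d = 0")
    case True
    have "b = 0"
    proof (rule ccontr)
      assume "b \<noteq> 0"
      then show False
        \<comment> \<open>With \<open>d = 0\<close> the quadratic is linear in \<open>r\<close>, and
          this value of \<open>r\<close> makes it equal to -1.\<close>
        using q[of "(a + 1) / (2 * b)"] True by simp
    qed
    then show ?thesis using True by simp
  next
    case False
    with nn have "d > 0" by simp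
    \<comment> \<open>The minimizer of the quadratic.\<close>
    with q[of "b / d"] show ?thesis
      by (simp add: field_simps power2_eq_square)
  qed
  then have "b\<^sup>2 \<le> (L2_norm L u * L2_norm L v)\<^sup>2"
    by (simp add: power_mult_distrib L2_norm_sq a_def d_def)
  then show ?thesis
    unfolding b_def by (metis L2_norm_nonneg abs_le_square_iff abs_of_nonneg mult_nonneg_nonneg)
qed

lemma L2_norm_triangle:
  assumes u: "L2_field L u" and v: "L2_field L v"
  shows "L2_norm L (\<lambda>x. u x + v x) \<le> L2_norm L u + L2_norm L v"
proof (rule power2_le_imp_le)
  have "(L2_norm L (\<lambda>x. u x + v x))\<^sup>2 = (L2_norm L u)\<^sup>2 + 2 * L2_inner L u v + (L2_norm L v)\<^sup>2"
    using u v by (simp add: L2_norm_sq L2_inner_linear L2_inner_commute[of L v u])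
  also have "\<dots> \<le> (L2_norm L u + L2_norm L v)\<^sup>2"
    using L2_Cauchy_Schwarz[OF u v] by (simp add: power2_sum)
  finally show "(L2_norm L (\<lambda>x. u x + v x))\<^sup>2 \<le> (L2_norm L u + L2_norm L v)\<^sup>2" .
qed simp

lemma L2_norm_triangle_diff:
  assumes "L2_field L u" "L2_field L v" "L2_field L w"
  shows "L2_norm L (\<lambda>x. u x - w x) \<le> L2_norm L (\<lambda>x. u x - v x) + L2_norm L (\<lambda>x. v x - w x)"
  using L2_norm_triangle[of L "\<lambda>x. u x - v x" "\<lambda>x. v x - w x"] assms by simp

lemma L2_norm_cong_AE:
  assumes "AE x in lebesgue_on (cube L). u x = u' x" "L2_field L u" "L2_field L u'"
  shows "L2_norm L u = L2_norm L u'"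
  unfolding L2_norm_def
  using assms by (intro arg_cong[where f = sqrt] integral_cong_AE) (auto dest: L2_fieldD(1))

lemma L2_norm_eq_0_AE:
  assumes "L2_field L u" "L2_norm L u = 0"
  shows "AE x in lebesgue_on (cube L). u x = 0"
proof -
  have "(LINT x|lebesgue_on (cube L). (norm (u x))\<^sup>2) = 0"
    using assms(2) by (simp add: L2_norm_def)
  then have "AE x in lebesgue_on (cube L). (norm (u x))\<^sup>2 = 0"
    using L2_fieldD(2)[OF assms(1)] by (subst (asm) integral_nonneg_eq_0_iff_AE) auto
  then show ?thesis by simp
qed

text \<open>Gram--Schmidt: the orthogonal projection onto the span of finitely many fields. The last
  conjunct says that \<open>p\<close> lies in that span.\<close>

lemma L2_projection:
  assumes "finite B" "B \<subseteq> V" and Lf: "\<And>b. b \<in> V \<Longrightarrow> L2_field L b" and zero: "(\<lambda>x. 0) \<in> V"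
    and add: "\<And>u v r. u \<in> V \<Longrightarrow> v \<in> V \<Longrightarrow> (\<lambda>x. u x + r *\<^sub>R v x) \<in> V"
    and "L2_field L v"
  shows "\<exists>p\<in>V. (\<forall>b\<in>B. L2_inner L (\<lambda>x. v x - p x) b = 0) \<and>
    (\<forall>w. L2_field L w \<longrightarrow> (\<forall>b\<in>B. L2_inner L w b = 0) \<longrightarrow> L2_inner L w p = 0)"
  using assms(1,2,6)
proof (induction B arbitrary: v rule: finite_induct)
  case empty
  then show ?case using zero by (intro bexI[of _ "\<lambda>x. 0"]) auto
next
  case (insert b B)
  then have bV: "b \<in> V" and BV: "B \<subseteq> V" by auto
  \<comment> \<open>The induction hypothesis is applied to two fields: to \<open>b\<close>, whose
    remainder \<open>d\<close> is orthogonal to \<open>B\<close>, and to \<open>v\<close>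
    itself.\<close>
  obtain q where q: "q \<in> V" "\<And>e. e \<in> B \<Longrightarrow> L2_inner L (\<lambda>x. b x - q x) e = 0"
      "\<And>w. L2_field L w \<Longrightarrow> (\<And>e. e \<in> B \<Longrightarrow> L2_inner L w e = 0) \<Longrightarrow> L2_inner L w q = 0"
    using insert.IH[OF BV Lf[OF bV]] by blast
  obtain p where p: "p \<in> V" "\<And>e. e \<in> B \<Longrightarrow> L2_inner L (\<lambda>x. v x - p x) e = 0"
      "\<And>w. L2_field L w \<Longrightarrow> (\<And>e. e \<in> B \<Longrightarrow> L2_inner L w e = 0) \<Longrightarrow> L2_inner L w p = 0"
    using insert.IH[OF BV insert.prems(2)] by blast
  define d where "d = (\<lambda>x. b x - q x)"
  have dV: "d \<in> V"
    unfolding d_def using add[OF bV q(1), of "-1"] by simp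
  \<comment> \<open>If \<open>d\<close> has norm zero, division by zero gives \<open>r = 0\<close>.
    This value is still right, since the numerator then vanishes by Cauchy-Schwarz.\<close>
  define r where "r = L2_inner L (\<lambda>x. v x - p x) d / L2_inner L d d"
  define p' where "p' = (\<lambda>x. p x + r *\<^sub>R d x)"
  have Lv: "L2_field L v" and Lq: "L2_field L q" and Ld: "L2_field L d" and Lb: "L2_field L b"
    and Lp: "L2_field L p" and Lp': "L2_field L p'"
    using insert.prems Lf q(1) p(1) dV bV by (auto simp: p'_def)
  have b_eq: "b = (\<lambda>x. d x + q x)" by (simp add: d_def)
  have dB: "L2_inner L d e = 0" if "e \<in> B" for e
    using q(2)[OF that] by (simp add: d_def)
  have eB: "L2_field L e" if "e \<in> B" for e
    using that BV Lf by auto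
  have v_eq: "(\<lambda>x. v x - p' x) = (\<lambda>x. (v x - p x) - r *\<^sub>R d x)"
    by (simp add: p'_def algebra_simps)
  have oB: "L2_inner L (\<lambda>x. v x - p' x) e = 0" if "e \<in> B" for e
    using p(2)[OF that] dB[OF that] Lv Lp Ld eB[OF that]
    unfolding v_eq by (simp add: L2_inner_diff_left[of L "\<lambda>x. v x - p x"] L2_inner_scaleR_left)
  have od: "L2_inner L (\<lambda>x. v x - p' x) d = 0"
  proof -
    have "L2_inner L (\<lambda>x. v x - p x) d = 0" if "L2_inner L d d = 0"
      using L2_Cauchy_Schwarz[of L "\<lambda>x. v x - p x" d] that Lv Lp Ld by (simp flip: L2_norm_sq)
    then have "L2_inner L (\<lambda>x. v x - p x) d = r * L2_inner L d d"
      by (auto simp: r_def)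
    then show ?thesis
      using Lv Lp Ld unfolding v_eq
      by (simp add: L2_inner_diff_left[of L "\<lambda>x. v x - p x"] L2_inner_scaleR_left)
  qed
  have oq: "L2_inner L (\<lambda>x. v x - p' x) q = 0"
    using oB Lv Lp' by (intro q(3)) auto
  have ob: "L2_inner L (\<lambda>x. v x - p' x) b = 0"
    unfolding b_eq using od oq Lv Lp' Ld Lq by (simp add: L2_inner_add_right)
  have sp: "L2_inner L w p' = 0" if w: "L2_field L w" "\<And>e. e \<in> insert b B \<Longrightarrow> L2_inner L w e = 0" for w
  proof -
    have "L2_inner L w q = 0" "L2_inner L w p = 0"
      using w by (auto intro: q(3) p(3))
    moreover have "L2_inner L w d = 0"
      unfolding d_def using w calculation Lb Lq by (simp add: L2_inner_diff_right)
    ultimately show ?thesis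
      unfolding p'_def using w Lp Ld by (simp add: L2_inner_linear)
  qed
  show ?case
    using ob oB sp add[OF p(1) dV, of r] by (intro bexI[of _ p']) (auto simp: p'_def)
qed

section \<open>Smooth fields\<close>

text \<open>A coinductive handle on smoothness: if every member has a gradient whose components are
  members again, derivatives of all orders exist. It serves trigonometric polynomials and cut-offs
  alike.\<close>

definition grad_closed :: "(real^3 \<Rightarrow> real) set \<Rightarrow> bool" where
  "grad_closed D \<longleftrightarrow> (\<forall>f\<in>D. \<exists>g. (\<forall>i. g i \<in> D) \<and>
     (\<forall>x. (f has_derivative (\<lambda>h. \<Sum>i\<in>UNIV. h $ i * g i x)) (at x)))"

lemma grad_closedE:
  assumes "grad_closed D" "\<And>j. (\<lambda>x. (v x :: real^3) $ j) \<in> D"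
  obtains g where "\<And>j i. g j i \<in> D"
    and "\<And>j x. ((\<lambda>x. v x $ j) has_derivative (\<lambda>h. \<Sum>i\<in>UNIV. h $ i * g j i x)) (at x)"
proof -
  have "\<exists>g. (\<forall>i. g i \<in> D) \<and>
     (\<forall>x. ((\<lambda>x. v x $ j) has_derivative (\<lambda>h. \<Sum>i\<in>UNIV. h $ i * g i x)) (at x))" for j
    using bspec[OF assms(1)[unfolded grad_closed_def] assms(2)] .
  then obtain g where "\<And>j. (\<forall>i. g j i \<in> D) \<and>
     (\<forall>x. ((\<lambda>x. v x $ j) has_derivative (\<lambda>h. \<Sum>i\<in>UNIV. h $ i * g j i x)) (at x))"
    by (rule that[OF someI_ex])
  then show ?thesis by (intro that[of g]) auto
qed

lemma field_has_derivative:
  fixes v :: field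
  assumes "\<And>j. ((\<lambda>x. v x $ j) has_derivative (\<lambda>h. \<Sum>i\<in>UNIV. h $ i * g j i x)) (at x)"
  shows "(v has_derivative (\<lambda>h. \<chi> j. \<Sum>i\<in>UNIV. h $ i * g j i x)) (at x)"
  unfolding has_derivative_componentwise_within[of v]
  using assms by (auto simp: Basis_vec_def inner_axis)

lemma partial_eq:
  fixes v :: field
  assumes "\<And>j. ((\<lambda>x. v x $ j) has_derivative (\<lambda>h. \<Sum>i\<in>UNIV. h $ i * g j i x)) (at x)"
  shows "partial i v x $ j = g j i x"
proof -
  have "frechet_derivative v (at x) = (\<lambda>h. \<chi> j. \<Sum>i\<in>UNIV. h $ i * g j i x)"
    using frechet_derivative_at[OF field_has_derivative[of v g x]] assms by simp
  then show ?thesis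
    by (simp add: partial_def axis_def if_distrib[of "\<lambda>y. y * _"] cong: if_cong)
qed

lemma grad_closed_C_k:
  assumes D: "grad_closed D" and "\<And>j. (\<lambda>x. v x $ j) \<in> D"
  shows "C_k_field k v"
  using assms(2)
proof (induction k arbitrary: v)
  case 0
  obtain g where g: "\<And>j i. g j i \<in> D"
    "\<And>j x. ((\<lambda>x. v x $ j) has_derivative (\<lambda>h. \<Sum>i\<in>UNIV. h $ i * g j i x)) (at x)"
    using grad_closedE[OF D, of v] 0 by blast
  have "isCont v x" for x
    using field_has_derivative[of v g x] g(2) by (blast intro: has_derivative_continuous)
  then show ?case by (simp add: continuous_on_eq_continuous_at)
next
  case (Suc k)
  obtain g where g: "\<And>j i. g j i \<in> D"
    "\<And>j x. ((\<lambda>x. v x $ j) has_derivative (\<lambda>h. \<Sum>i\<in>UNIV. h $ i * g j i x)) (at x)"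
    using grad_closedE[OF D, of v] Suc.prems by blast
  have "v differentiable_on UNIV"
    using field_has_derivative[of v g] g(2)
    unfolding differentiable_on_def differentiable_def by (blast intro: has_derivative_at_withinI)
  moreover have "C_k_field k (partial i v)" for i
  proof (rule Suc.IH)
    fix j
    have "(\<lambda>x. partial i v x $ j) = g j i"
      using partial_eq[of v g] g(2) by blast
    then show "(\<lambda>x. partial i v x $ j) \<in> D"
      using g(1) by simp
  qed
  ultimately show ?case by simp
qed

lemma grad_closed_smooth:
  assumes "grad_closed D" "\<And>j. (\<lambda>x. v x $ j) \<in> D"
  shows "smooth_field v"
  using grad_closed_C_k[OF assms] by (simp add: smooth_field_def)

lemma smooth_field_continuous: "smooth_field v \<Longrightarrow> continuous_on UNIV v"
  unfolding smooth_field_def by (metis C_k_field.simps(1))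

lemma continuous_curl:
  assumes "smooth_field v"
  shows "continuous_on UNIV (curl v)"
proof -
  have "C_k_field (Suc 0) v"
    using assms unfolding smooth_field_def by blast
  then have p: "continuous_on UNIV (partial i v)" for i by simp
  show ?thesis
    unfolding continuous_on_componentwise[of _ "curl v"]
  proof
    fix b :: "real^3" assume "b \<in> Basis"
    then obtain j where b: "b = axis j 1" by (auto simp: Basis_vec_def)
    have "j = 1 \<or> j = 2 \<or> j = 3" using exhaust_3 by blast
    then show "continuous_on UNIV (\<lambda>x. curl v x \<bullet> b)"
      by (elim disjE) (simp_all add: b curl_def inner_axis continuous_intros p)
  qed
qed

subsection \<open>Bump functions\<close>

text \<open>For \<open>k = 0\<close> this is the classical function exp(-1/t) that is flat at 0. The
  powers of 1/t are included because differentiation produces them; with them the span of the family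
  is closed under derivatives.\<close>

definition exp_bump :: "nat \<Rightarrow> real \<Rightarrow> real" where
  "exp_bump k t = (if t > 0 then exp (- inverse t) * inverse t ^ k else 0)"

lemma exp_bump_tendsto_0: "(exp_bump k \<longlongrightarrow> 0) (at_right 0)"
proof -
  have "((\<lambda>t::real. inverse t ^ k / exp (inverse t)) \<longlongrightarrow> 0) (at_right 0)"
    by (rule filterlim_compose[OF tendsto_power_div_exp_0 filterlim_inverse_at_top_right])
  moreover have "\<forall>\<^sub>F t in at_right 0. inverse t ^ k / exp (inverse t) = exp_bump k t"
    unfolding eventually_at_right_field
    by (intro exI[of _ 1]) (auto simp: exp_bump_def exp_minus divide_inverse mult.commute)
  ultimately show ?thesis
    by (rule Lim_transform_eventually)
qed

lemma exp_bump_has_derivative: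
  "(exp_bump k has_real_derivative exp_bump (k + 2) t - real k * exp_bump (k + 1) t) (at t)"
proof -
  consider "t > 0" | "t < 0" | "t = 0" by linarith
  then show ?thesis
  proof cases
    case 1
    define u where "u = inverse t"
    have "((\<lambda>u. exp (- u) * u ^ k) has_real_derivative
        real k * u ^ (k - 1) * exp (- u) - exp (- u) * u ^ k) (at u)"
      by (auto intro!: derivative_eq_intros)
    from DERIV_chain2[OF this[unfolded u_def] DERIV_inverse[of t]] 1
    have "((\<lambda>t. exp (- inverse t) * inverse t ^ k) has_real_derivative
        (real k * u ^ (k - 1) * exp (- u) - exp (- u) * u ^ k) * - (u ^ 2)) (at t)"
      by (simp add: u_def numeral_2_eq_2)
    also have "(real k * u ^ (k - 1) * exp (- u) - exp (- u) * u ^ k) * - (u ^ 2)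
        = exp (- u) * u ^ (k + 2) - real k * (exp (- u) * u ^ (k + 1))"
      by (cases k) (simp_all add: algebra_simps power2_eq_square)
    also have "\<dots> = exp_bump (k + 2) t - real k * exp_bump (k + 1) t"
      using 1 by (simp add: exp_bump_def u_def)
    finally have "((\<lambda>t. exp (- inverse t) * inverse t ^ k) has_real_derivative
        exp_bump (k + 2) t - real k * exp_bump (k + 1) t) (at t)" .
    moreover have "\<forall>\<^sub>F t in nhds t. exp_bump k t = exp (- inverse t) * inverse t ^ k"
      using eventually_nhds_in_open[of "{0<..}" t] 1
      by (auto simp: exp_bump_def elim!: eventually_mono)
    ultimately show ?thesis
      by (subst DERIV_cong_ev[OF refl _ refl])
  next
    case 2
    have "((\<lambda>t. 0) has_real_derivative exp_bump (k + 2) t - real k * exp_bump (k + 1) t) (at t)"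
      using 2 by (simp add: exp_bump_def)
    moreover have "\<forall>\<^sub>F t in nhds t. exp_bump k t = 0"
      using eventually_nhds_in_open[of "{..<0}" t] 2
      by (auto simp: exp_bump_def elim!: eventually_mono)
    ultimately show ?thesis
      by (subst DERIV_cong_ev[OF refl _ refl])
  next
    case 3
    have "((\<lambda>h. (exp_bump k (0 + h) - exp_bump k 0) / h) \<longlongrightarrow> 0) (at 0)"

    proof (rule filterlim_split_at_real)
      \<comment> \<open>Dividing by \<open>h\<close> raises the exponent by one, so the right-hand
        difference quotient is itself a member of the family that tends to 0.\<close>
      have "\<forall>\<^sub>F h in at_right 0. exp_bump (k + 1) h = (exp_bump k (0 + h) - exp_bump k 0) / h"
        unfolding eventually_at_right_field
        by (intro exI[of _ 1]) (auto simp: exp_bump_def divide_inverse)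
      then show "((\<lambda>h. (exp_bump k (0 + h) - exp_bump k 0) / h) \<longlongrightarrow> 0) (at_right 0)"
        by (rule Lim_transform_eventually[OF exp_bump_tendsto_0])
      have "\<forall>\<^sub>F h in at_left 0. 0 = (exp_bump k (0 + h) - exp_bump k 0) / h"
        unfolding eventually_at_left_field
        by (intro exI[of _ "-1"]) (auto simp: exp_bump_def)
      then show "((\<lambda>h. (exp_bump k (0 + h) - exp_bump k 0) / h) \<longlongrightarrow> 0) (at_left 0)"
        by (rule Lim_transform_eventually[OF tendsto_const])
    qed
    then show ?thesis
      using 3 by (simp add: DERIV_def exp_bump_def)
  qed
qed

text \<open>Large enough for products of cut-offs with trigonometric polynomials, and closed under
  differentiation: all exponents \<open>k\<close> are present, and the free phase turns -sin into a
  shifted cosine.\<close>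

inductive_set smooth_alg :: "(real^3 \<Rightarrow> real) set" where
  const: "(\<lambda>x. r) \<in> smooth_alg"
| bump: "(\<lambda>x. exp_bump k (a \<bullet> x + b)) \<in> smooth_alg"
| cos: "(\<lambda>x. cos (a \<bullet> x + b)) \<in> smooth_alg"
| add: "f \<in> smooth_alg \<Longrightarrow> g \<in> smooth_alg \<Longrightarrow> (\<lambda>x. f x + g x) \<in> smooth_alg"
| mult: "f \<in> smooth_alg \<Longrightarrow> g \<in> smooth_alg \<Longrightarrow> (\<lambda>x. f x * g x) \<in> smooth_alg"

lemma has_derivative_ridge:
  assumes "(\<phi> has_real_derivative d) (at (a \<bullet> x + b))"
  shows "((\<lambda>x. \<phi> (a \<bullet> x + b)) has_derivative (\<lambda>h. \<Sum>i\<in>UNIV. h $ i * (a $ i * d))) (at (x::real^3))"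
proof -
  have "((\<lambda>x. a \<bullet> x + b) has_derivative (\<lambda>h. a \<bullet> h)) (at x)"
    by (auto intro!: derivative_eq_intros)
  from has_derivative_compose[OF this assms[unfolded has_field_derivative_def]]
  show ?thesis
    by (simp add: inner_vec_def sum_distrib_left sum_distrib_right mult_ac)
qed

lemma grad_closed_smooth_alg: "grad_closed smooth_alg"
  unfolding grad_closed_def
proof
  fix f assume "f \<in> smooth_alg"
  then show "\<exists>g. (\<forall>i. g i \<in> smooth_alg) \<and>
     (\<forall>x. (f has_derivative (\<lambda>h. \<Sum>i\<in>UNIV. h $ i * g i x)) (at x))"
  proof induction
    case (const r)
    show ?case
      by (intro exI[of _ "\<lambda>i x. 0"]) (auto intro: smooth_alg.const)
  next
    case (bump k a b)
    have "(\<lambda>x. a $ i * (exp_bump (k + 2) (a \<bullet> x + b) + (- real k) * exp_bump (k + 1) (a \<bullet> x + b)))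
        \<in> smooth_alg" for i
      by (intro smooth_alg.intros)
    then show ?case
      using has_derivative_ridge[OF exp_bump_has_derivative]
      by (intro exI[of _ "\<lambda>i x. a $ i * (exp_bump (k + 2) (a \<bullet> x + b)
        + (- real k) * exp_bump (k + 1) (a \<bullet> x + b))"]) simp
  next
    case (cos a b)
    have "(\<lambda>x. a $ i * cos (a \<bullet> x + (b + pi / 2))) \<in> smooth_alg" for i
      by (intro smooth_alg.intros)
    moreover have d: "(cos has_real_derivative cos (t + pi / 2)) (at t)" for t :: real
      by (auto intro!: derivative_eq_intros simp: cos_add)
    ultimately show ?case
      using has_derivative_ridge[OF d]
      by (intro exI[of _ "\<lambda>i x. a $ i * cos (a \<bullet> x + (b + pi / 2))"]) (simp add: add.assoc)
  next
    case (add f g)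
    then obtain f' g' where *: "\<And>i. f' i \<in> smooth_alg" "\<And>i. g' i \<in> smooth_alg"
      "\<And>x. (f has_derivative (\<lambda>h. \<Sum>i\<in>UNIV. h $ i * f' i x)) (at x)"
      "\<And>x. (g has_derivative (\<lambda>h. \<Sum>i\<in>UNIV. h $ i * g' i x)) (at x)"
      by blast
    have "(\<lambda>x. f' i x + g' i x) \<in> smooth_alg" for i
      by (intro smooth_alg.intros *)
    moreover have "((\<lambda>x. f x + g x) has_derivative (\<lambda>h. \<Sum>i\<in>UNIV. h $ i * (f' i x + g' i x))) (at x)" for x
      using has_derivative_add[OF *(3,4)] by (simp add: sum.distrib algebra_simps)
    ultimately show ?case
      by (intro exI[of _ "\<lambda>i x. f' i x + g' i x"]) simp
  next
    case (mult f g)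
    then obtain f' g' where *: "\<And>i. f' i \<in> smooth_alg" "\<And>i. g' i \<in> smooth_alg"
      "\<And>x. (f has_derivative (\<lambda>h. \<Sum>i\<in>UNIV. h $ i * f' i x)) (at x)"
      "\<And>x. (g has_derivative (\<lambda>h. \<Sum>i\<in>UNIV. h $ i * g' i x)) (at x)"
      by blast
    have "(\<lambda>x. f x * g' i x + f' i x * g x) \<in> smooth_alg" for i
      by (intro smooth_alg.intros * mult.hyps)
    moreover have "((\<lambda>x. f x * g x) has_derivative (\<lambda>h. \<Sum>i\<in>UNIV. h $ i * (f x * g' i x + f' i x * g x))) (at x)" for x
      using has_derivative_mult[OF *(3,4)]
      by (simp add: sum.distrib algebra_simps sum_distrib_left sum_distrib_right)
    ultimately show ?case
      by (intro exI[of _ "\<lambda>i x. f x * g' i x + f' i x * g x"]) simp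
  qed
qed

section \<open>Periodic trigonometric fields\<close>

text \<open>The phase covers cosine and sine at once. A derivative shifts it by pi/2 and keeps the
  frequency, which is why the curl preserves sets of frequencies.\<close>

definition wave :: "real \<Rightarrow> real^3 \<Rightarrow> real \<Rightarrow> real^3 \<Rightarrow> real" where
  "wave L k \<theta> x = cos (2 * pi / L * (k \<bullet> x) + \<theta>)"

definition int_freqs :: "(real^3) set" where
  "int_freqs = {k. \<forall>i. k $ i \<in> \<int>}"

text \<open>Fubini for functions that factor over the coordinates. The values are complex because an
  exponential factors in this way and a cosine does not.\<close>

lemma integral_cube_prod:
  fixes g :: "real^3 \<Rightarrow> real \<Rightarrow> complex"
  assumes g: "\<And>b. continuous_on UNIV (g b)"
  shows "(LINT x|lebesgue_on (cube L). (\<Prod>b\<in>Basis. g b (x \<bullet> b)))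
    = (\<Prod>b\<in>Basis. (LINT t|lborel. indicator {0..L} t *\<^sub>R g b t))"
proof -
  interpret product_sigma_finite "\<lambda>b::real^3. lborel :: real measure"
    by unfold_locales
  have gm [measurable]: "g b \<in> borel_measurable borel" for b
    using g by (rule borel_measurable_continuous_onI)
  have ind: "indicator (cube L) x = (\<Prod>b\<in>Basis. indicator {0..L} (x \<bullet> b) :: real)" for x
  proof -
    have "x \<in> cube L \<longleftrightarrow> (\<forall>b\<in>Basis. x \<bullet> b \<in> {0..L})"
      by (auto simp: cube_def mem_box Basis_vec_def inner_axis)
    then show ?thesis
      by (auto simp: indicator_def prod_zero_iff)
  qed
  have cm [measurable]: "(\<lambda>x. indicator (cube L) x *\<^sub>R (\<Prod>b\<in>Basis. g b (x \<bullet> b))) \<in> borel_measurable borel"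
    unfolding cube_def by measurable
  have "(LINT x|lebesgue_on (cube L). (\<Prod>b\<in>Basis. g b (x \<bullet> b)))
      = (LINT x|lebesgue. indicator (cube L) x *\<^sub>R (\<Prod>b\<in>Basis. g b (x \<bullet> b)))"
    by (rule integral_restrict_space) (simp add: cube_def)
  also have "\<dots> = (LINT x|lborel. indicator (cube L) x *\<^sub>R (\<Prod>b\<in>Basis. g b (x \<bullet> b)))"
    by (rule integral_completion) (use cm in simp)
  also have "\<dots> = (LINT x|lborel. (\<Prod>b\<in>Basis. indicator {0..L} (x \<bullet> b) *\<^sub>R g b (x \<bullet> b)))"
    by (simp add: ind scaleR_conv_of_real prod.distrib)
  also have "\<dots> = (LINT y|Pi\<^sub>M Basis (\<lambda>b. lborel). (\<Prod>b\<in>Basis. indicator {0..L} (y b) *\<^sub>R g b (y b)))"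
    by (subst lborel_eq, subst integral_distr) (auto intro!: Bochner_Integration.integral_cong prod.cong)
  also have "\<dots> = (\<Prod>b\<in>Basis. (LINT t|lborel. indicator {0..L} t *\<^sub>R g b t))"
  proof (rule product_integral_prod)
    fix b :: "real^3"
    have "integrable lborel (\<lambda>t. indicator {0..L} t *\<^sub>R g b t)"
      using borel_integrable_compact[of "{0..L}" "g b"] g
      by (auto simp: intro: continuous_on_subset)
    then show "integrable lborel (\<lambda>t. indicator {0..L} t *\<^sub>R g b t)" .
  qed simp
  finally show ?thesis .
qed

lemma integral_cis_period:
  assumes L: "L > 0" and n: "n \<in> \<int>" "n \<noteq> 0"
  shows "(LINT t|lborel. indicator {0..L} t *\<^sub>R cis (2 * pi / L * n * t)) = 0"
proof -
  define a where "a = 2 * pi / L * n"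
  have a: "a \<noteq> 0" using L n by (simp add: a_def)
  define F where "F = (\<lambda>z. exp (\<i> * of_real a * z) / (\<i> * of_real a))"
  have "((\<lambda>t. F (of_real t)) has_vector_derivative cis (a * t)) (at t within {0..L})" for t
  proof (rule has_vector_derivative_real_field)
    show "(F has_field_derivative cis (a * t)) (at (of_real t))"
      unfolding F_def using a
      by (auto intro!: derivative_eq_intros simp: cis_conv_exp mult_ac)
  qed
  then have "(LINT t|lborel. indicator {0..L} t *\<^sub>R cis (a * t)) = F (of_real L) - F (of_real 0)"
    using L by (intro integral_FTC_atLeastAtMost) (auto intro!: continuous_intros)
  also have "exp (\<i> * of_real a * of_real L) = 1"
  proof -
    obtain m where m: "n = of_int m" using n(1) by (auto elim: Ints_cases)
    have "exp (\<i> * of_real a * of_real L) = cis (2 * pi * n)"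
      using L by (simp add: cis_conv_exp a_def)
    also have "\<dots> = 1" by (rule cis_multiple_2pi[OF n(1)])
    finally show ?thesis .
  qed
  then have "F (of_real L) - F (of_real 0) = 0" by (simp add: F_def)
  finally show ?thesis by (simp add: a_def)
qed

text \<open>A wave is the real part of a complex exponential, whose integral is a product over the
  coordinates; the factor of coordinate \<open>i\<close> runs over a nonzero whole number of periods
  and vanishes.\<close>

lemma integral_wave:
  assumes L: "L > 0" and k: "k \<in> int_freqs" "k $ i \<noteq> 0"
  shows "(LINT x|lebesgue_on (cube L). wave L k \<theta> x) = 0"
proof -
  define g where "g = (\<lambda>(b::real^3) t. cis (2 * pi / L * (k \<bullet> b) * t))"
  have g: "continuous_on UNIV (g b)" for b
    unfolding g_def by (intro continuous_intros)
  have eq: "cis (2 * pi / L * (k \<bullet> x) + \<theta>) = cis \<theta> * (\<Prod>b\<in>Basis. g b (x \<bullet> b))" for x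
  proof -
    have "k \<bullet> x = (\<Sum>b\<in>Basis. (k \<bullet> b) * (x \<bullet> b))" by (rule euclidean_inner)
    then have "2 * pi / L * (k \<bullet> x) = (\<Sum>b\<in>Basis. 2 * pi / L * (k \<bullet> b) * (x \<bullet> b))"
      by (simp add: sum_distrib_left mult.assoc)
    moreover have "cis (\<Sum>b\<in>B. f b) = (\<Prod>b\<in>B. cis (f b))" for B :: "(real^3) set" and f
      by (induction B rule: infinite_finite_induct) (auto simp flip: cis_mult)
    ultimately show ?thesis by (simp add: g_def mult.commute flip: cis_mult)
  qed
  have "(LINT x|lebesgue_on (cube L). cis (2 * pi / L * (k \<bullet> x) + \<theta>))
      = cis \<theta> * (\<Prod>b\<in>Basis. (LINT t|lborel. indicator {0..L} t *\<^sub>R g b t))"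
    unfolding eq by (simp add: integral_cube_prod[OF g])
  also have "(LINT t|lborel. indicator {0..L} t *\<^sub>R g (axis i 1) t) = 0"
    unfolding g_def using k by (intro integral_cis_period[OF L]) (auto simp: int_freqs_def inner_axis)
  then have "(\<Prod>b\<in>Basis. (LINT t|lborel. indicator {0..L} t *\<^sub>R g b t)) = 0"
    by (intro prod_zero) (auto simp: Basis_vec_def)
  finally have z: "(LINT x|lebesgue_on (cube L). cis (2 * pi / L * (k \<bullet> x) + \<theta>)) = 0" by simp
  have "integrable (lebesgue_on (cube L)) (\<lambda>x. cis (2 * pi / L * (k \<bullet> x) + \<theta>))"
    unfolding cube_def by (intro continuous_imp_integrable continuous_intros)
  from integral_Re[OF this] z show ?thesis by (simp add: wave_def)
qed

text \<open>The set \<open>K\<close> of frequencies is tracked because the projections exist only on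
  the finite dimensional spaces that belong to finite \<open>K\<close>.\<close>

inductive_set trig :: "real \<Rightarrow> (real^3) set \<Rightarrow> (real^3 \<Rightarrow> real) set"
  for L :: real and K :: "(real^3) set" where
  zero: "(\<lambda>x. 0) \<in> trig L K"
| wave: "f \<in> trig L K \<Longrightarrow> k \<in> K \<Longrightarrow> (\<lambda>x. f x + a * wave L k \<theta> x) \<in> trig L K"

lemma trig_wave:
  "k \<in> K \<Longrightarrow> (\<lambda>x. a * wave L k \<theta> x) \<in> trig L K"
  using trig.wave[OF trig.zero, of k K a L \<theta>] by simp

lemma trig_add:
  assumes "f \<in> trig L K" "g \<in> trig L K"
  shows "(\<lambda>x. f x + g x) \<in> trig L K"
  using assms(2)
proof induction
  case zero
  then show ?case using assms(1) by simp
next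
  case (wave g k a \<theta>)
  then show ?case
    using trig.wave[of "\<lambda>x. f x + g x" L K k a \<theta>] by (simp add: add.assoc)
qed

lemma trig_scale:
  assumes "f \<in> trig L K"
  shows "(\<lambda>x. r * f x) \<in> trig L K"
  using assms
proof induction
  case zero
  then show ?case by (simp add: trig.zero)
next
  case (wave f k a \<theta>)
  then show ?case
    using trig.wave[of "\<lambda>x. r * f x" L K k "r * a" \<theta>] by (simp add: distrib_left mult.assoc)
qed

lemma trig_diff:
  assumes "f \<in> trig L K" "g \<in> trig L K"
  shows "(\<lambda>x. f x - g x) \<in> trig L K"
  using trig_add[OF assms(1) trig_scale[OF assms(2), of "-1"]] by simp

lemma continuous_on_wave: "continuous_on S (wave L k \<theta>)"
  unfolding wave_def by (intro continuous_intros)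

lemma continuous_on_trig:
  assumes "f \<in> trig L K"
  shows "continuous_on S f"
  using assms by induction (auto intro!: continuous_intros continuous_on_wave)

lemma integrable_cube_continuous:
  fixes f :: "real^3 \<Rightarrow> real"
  shows "continuous_on (cube L) f \<Longrightarrow> integrable (lebesgue_on (cube L)) f"
  unfolding cube_def by (rule continuous_imp_integrable)

lemma trig_mono:
  assumes "f \<in> trig L K" "K \<subseteq> K'"
  shows "f \<in> trig L K'"
  using assms by (induction) (auto intro: trig.intros)

lemma trig_finite:
  assumes "f \<in> trig L K"
  shows "\<exists>F. finite F \<and> F \<subseteq> K \<and> f \<in> trig L F"
  using assms
proof induction
  case zero
  then show ?case using trig.zero by blast
next
  case (wave f k a \<theta>)
  then obtain F where "finite F" "F \<subseteq> K" "f \<in> trig L F" by blast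
  with wave(2) show ?case
    by (intro exI[of _ "insert k F"]) (auto intro!: trig.wave intro: trig_mono)
qed

lemma int_freqs_closed:
  "0 \<in> int_freqs" "k \<in> int_freqs \<Longrightarrow> l \<in> int_freqs \<Longrightarrow> k + l \<in> int_freqs"
  "k \<in> int_freqs \<Longrightarrow> l \<in> int_freqs \<Longrightarrow> k - l \<in> int_freqs" "axis i 1 \<in> int_freqs"
  by (auto simp: int_freqs_def axis_def)

lemma trig_const: "(\<lambda>x. r) \<in> trig L int_freqs"
  using trig_wave[OF int_freqs_closed(1), of r L 0] by (simp add: wave_def)

lemma wave_mult:
  "wave L k \<theta> x * wave L l \<eta> x = 1 / 2 * wave L (k - l) (\<theta> - \<eta>) x + 1 / 2 * wave L (k + l) (\<theta> + \<eta>) x"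
proof -
  have "2 * pi / L * ((k - l) \<bullet> x) + (\<theta> - \<eta>)
      = (2 * pi / L * (k \<bullet> x) + \<theta>) - (2 * pi / L * (l \<bullet> x) + \<eta>)"
    "2 * pi / L * ((k + l) \<bullet> x) + (\<theta> + \<eta>)
      = (2 * pi / L * (k \<bullet> x) + \<theta>) + (2 * pi / L * (l \<bullet> x) + \<eta>)"
    by (simp_all only: inner_diff_left inner_add_left ring_distribs)
  moreover have "cos A * cos B = 1 / 2 * cos (A - B) + 1 / 2 * cos (A + B)" for A B :: real
    by (simp add: cos_times_cos)
  ultimately show ?thesis
    unfolding wave_def by metis
qed

text \<open>Products add and subtract frequencies, hence the full lattice instead of a set
  \<open>K\<close>. Both the Stone-Weierstrass argument and integration by parts multiply
  polynomials.\<close>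

lemma trig_mult:
  assumes "f \<in> trig L int_freqs" "g \<in> trig L int_freqs"
  shows "(\<lambda>x. f x * g x) \<in> trig L int_freqs"
  using assms(1)
proof induction
  case zero
  then show ?case by (simp add: trig.zero)
next
  case (wave f k a \<theta>)
  have "(\<lambda>x. wave L k \<theta> x * g x) \<in> trig L int_freqs"
    using assms(2)
  proof induction
    case zero
    then show ?case by (simp add: trig.zero)
  next
    case (wave g l b \<eta>)
    have "(\<lambda>x. b * (wave L k \<theta> x * wave L l \<eta> x)) \<in> trig L int_freqs"
      unfolding wave_mult using wave \<open>k \<in> int_freqs\<close>
      by (intro trig_scale trig_add trig_wave int_freqs_closed)
    from trig_add[OF wave.IH this] show ?case by (simp add: algebra_simps)
  qed
  from trig_add[OF wave.IH trig_scale[OF this, of a]] show ?case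
    by (simp add: algebra_simps)
qed

lemma wave_has_derivative:
  "(wave L k \<theta> has_derivative (\<lambda>h. \<Sum>i\<in>UNIV. h $ i * (2 * pi / L * k $ i * wave L k (\<theta> + pi / 2) x))) (at x)"
proof -
  have d: "(cos has_real_derivative cos (t + pi / 2)) (at t)" for t :: real
    by (auto intro!: derivative_eq_intros simp: cos_add)
  have "wave L k \<theta> = (\<lambda>x. cos ((2 * pi / L) *\<^sub>R k \<bullet> x + \<theta>))"
    by (simp add: wave_def fun_eq_iff)
  then show ?thesis
    using has_derivative_ridge[of cos _ "(2 * pi / L) *\<^sub>R k" x \<theta>, OF d]
    by (simp add: wave_def add.assoc)
qed

text \<open>The derivative of a wave in direction \<open>i\<close> carries the factor
  \<open>k $ i\<close>. Either this factor is zero or the wave itself has mean zero by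
  \<open>integral_wave\<close>; in both cases the mean vanishes.\<close>

lemma trig_gradient:
  assumes "L > 0" "f \<in> trig L K" "K \<subseteq> int_freqs"
  shows "\<exists>g. (\<forall>i. g i \<in> trig L K) \<and>
     (\<forall>x. (f has_derivative (\<lambda>h. \<Sum>i\<in>UNIV. h $ i * g i x)) (at x)) \<and>
     (\<forall>i. (LINT x|lebesgue_on (cube L). g i x) = 0)"
  using assms(2)
proof induction
  case zero
  show ?case by (intro exI[of _ "\<lambda>i x. 0"]) (auto intro: trig.zero)
next
  case (wave f k a \<theta>)
  then obtain g where g: "\<And>i. g i \<in> trig L K"
      "\<And>x. (f has_derivative (\<lambda>h. \<Sum>i\<in>UNIV. h $ i * g i x)) (at x)"
      "\<And>i. (LINT x|lebesgue_on (cube L). g i x) = 0"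
    by blast
  define g' where "g' = (\<lambda>i x. g i x + (a * (2 * pi / L * k $ i)) * wave L k (\<theta> + pi / 2) x)"
  have "g' i \<in> trig L K" for i
    unfolding g'_def using g(1) wave(2) by (intro trig_add trig_wave)
  moreover have "((\<lambda>x. f x + a * wave L k \<theta> x) has_derivative (\<lambda>h. \<Sum>i\<in>UNIV. h $ i * g' i x)) (at x)" for x
    using has_derivative_add[OF g(2) has_derivative_mult_right[OF wave_has_derivative, of a L k \<theta> x]]
    by (simp add: g'_def sum.distrib distrib_left sum_distrib_left mult_ac)
  moreover have "(LINT x|lebesgue_on (cube L). g' i x) = 0" for i
  proof -
    have "(LINT x|lebesgue_on (cube L). g' i x) = (LINT x|lebesgue_on (cube L). g i x)
        + (LINT x|lebesgue_on (cube L). (a * (2 * pi / L * k $ i)) * wave L k (\<theta> + pi / 2) x)"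
      unfolding g'_def
      by (intro Bochner_Integration.integral_add integrable_cube_continuous continuous_intros
          continuous_on_trig[OF g(1)] continuous_on_wave)
    also have "\<dots> = 0"
      using integral_wave[OF assms(1), of k i "\<theta> + pi / 2"] wave(2) assms(3) g(3)
      by (cases "k $ i = 0") auto
    finally show ?thesis .
  qed
  ultimately show ?case by blast
qed

section \<open>Trigonometric vector fields and their curl\<close>

definition trig_field :: "real \<Rightarrow> (real^3) set \<Rightarrow> field set" where
  "trig_field L K = {v. \<forall>j. (\<lambda>x. v x $ j) \<in> trig L K}"

lemma grad_closed_trig:
  assumes "L > 0" "K \<subseteq> int_freqs"
  shows "grad_closed (trig L K)"
  unfolding grad_closed_def
proof
  fix f assume "f \<in> trig L K"
  from trig_gradient[OF assms(1) this assms(2)]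
  obtain g where "\<forall>i. g i \<in> trig L K"
    "\<forall>x. (f has_derivative (\<lambda>h. \<Sum>i\<in>UNIV. h $ i * g i x)) (at x)"
    by (elim exE conjE) (rule that)
  then show "\<exists>g. (\<forall>i. g i \<in> trig L K) \<and>
      (\<forall>x. (f has_derivative (\<lambda>h. \<Sum>i\<in>UNIV. h $ i * g i x)) (at x))"
    by (intro exI conjI)
qed

lemma gradient_unique:
  fixes f :: "real^3 \<Rightarrow> real"
  assumes "(f has_derivative (\<lambda>h. \<Sum>i\<in>UNIV. h $ i * g i)) (at x)"
    and "(f has_derivative (\<lambda>h. \<Sum>i\<in>UNIV. h $ i * g' i)) (at x)"
  shows "g i = g' i"
proof -
  have "(\<Sum>j\<in>UNIV. axis i 1 $ j * g j) = (\<Sum>j\<in>UNIV. axis i 1 $ j * g' j)"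
    using fun_cong[OF has_derivative_unique[OF assms], of "axis i 1"] .
  then show ?thesis
    by (simp add: axis_def if_distrib[of "\<lambda>y. y * _"] cong: if_cong)
qed

lemma trig_field_add_scaleR:
  assumes "u \<in> trig_field L K" "v \<in> trig_field L K"
  shows "(\<lambda>x. u x + r *\<^sub>R v x) \<in> trig_field L K"
  using assms by (simp add: trig_field_def trig_add trig_scale)

lemma trig_field_zero: "(\<lambda>x. 0) \<in> trig_field L K"
  by (simp add: trig_field_def trig.zero)

lemma trig_field_mono: "v \<in> trig_field L K \<Longrightarrow> K \<subseteq> K' \<Longrightarrow> v \<in> trig_field L K'"
  by (auto simp: trig_field_def intro: trig_mono)

lemma trig_field_smooth:
  assumes "L > 0" "K \<subseteq> int_freqs" "v \<in> trig_field L K"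
  shows "smooth_field v"
  using assms(3) by (intro grad_closed_smooth[OF grad_closed_trig[OF assms(1,2)]]) (simp add: trig_field_def)

lemma trig_field_L2:
  assumes "v \<in> trig_field L K"
  shows "L2_field L v"
proof (rule L2_field_continuous)
  have "continuous_on UNIV (\<lambda>x. \<chi> j. v x $ j)"
    using assms by (intro continuous_intros continuous_on_trig) (auto simp: trig_field_def)
  then show "continuous_on UNIV v" by simp
qed

lemma trig_periodic:
  assumes "L > 0" "f \<in> trig L K" "K \<subseteq> int_freqs"
  shows "f (x + L *\<^sub>R axis i 1) = f x"
  using assms(2)
proof induction
  case (wave f k a \<theta>)
  then have "k $ i \<in> \<int>" using assms(3) by (auto simp: int_freqs_def)
  then obtain m where m: "k $ i = of_int m" by (auto elim: Ints_cases)
  have "2 * pi / L * (k \<bullet> (x + L *\<^sub>R axis i 1)) + \<theta> = (2 * pi / L * (k \<bullet> x) + \<theta>) + 2 * pi * of_int m"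
    using assms(1) m by (simp add: inner_add_right inner_axis field_simps)
  then have "wave L k \<theta> (x + L *\<^sub>R axis i 1) = wave L k \<theta> x"
    unfolding wave_def by (simp only: cos_add sin_int_2pin cos_int_2pin) simp
  with wave show ?case by simp
qed simp

lemma trig_field_periodic_test:
  assumes "L > 0" "K \<subseteq> int_freqs" "v \<in> trig_field L K"
  shows "v \<in> periodic_test L"
  using trig_field_smooth[OF assms] trig_periodic[OF assms(1) _ assms(2)] assms(3)
  by (auto simp: periodic_test_def trig_field_def vec_eq_iff)

lemma curl_components:
  assumes "\<And>j x. ((\<lambda>x. v x $ j) has_derivative (\<lambda>h. \<Sum>i\<in>UNIV. h $ i * g j i x)) (at x)"
  shows "curl v x = vector [g 3 2 x - g 2 3 x, g 1 3 x - g 3 1 x, g 2 1 x - g 1 2 x]"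
proof -
  have "partial i v x $ j = g j i x" for i j
    using assms by (rule partial_eq)
  then show ?thesis by (simp add: curl_def)
qed

lemma curl_trig_field:
  assumes "L > 0" "K \<subseteq> int_freqs" "v \<in> trig_field L K"
  shows "curl v \<in> trig_field L K"
proof -
  obtain g where g: "\<And>j i. g j i \<in> trig L K"
    "\<And>j x. ((\<lambda>x. v x $ j) has_derivative (\<lambda>h. \<Sum>i\<in>UNIV. h $ i * g j i x)) (at x)"
    by (rule grad_closedE[OF grad_closed_trig[OF assms(1,2)], of v]) (use assms(3) in \<open>auto simp: trig_field_def\<close>)
  have c: "curl v x = vector [g 3 2 x - g 2 3 x, g 1 3 x - g 3 1 x, g 2 1 x - g 1 2 x]" for x
    by (rule curl_components[OF g(2)])
  have "(\<lambda>x. curl v x $ j) \<in> trig L K" for j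
    using exhaust_3[of j] by (elim disjE) (simp_all add: c trig_diff g(1))
  then show ?thesis by (simp add: trig_field_def)
qed

text \<open>\<open>curl p \<bullet> q - p \<bullet> curl q\<close> is the divergence of \<open>p \<times> q\<close>, and the partial derivatives of
  periodic trigonometric polynomials have mean zero.\<close>

lemma trig_field_Green:
  assumes L: "L > 0" and p: "p \<in> trig_field L int_freqs" and q: "q \<in> trig_field L int_freqs"
  shows "L2_inner L (curl p) q = L2_inner L p (curl q)"
proof -
  let ?M = "lebesgue_on (cube L)" and ?T = "trig L int_freqs"
  note gc = grad_closed_trig[OF L subset_refl]
  obtain g where g: "\<And>j i. g j i \<in> ?T"
    "\<And>j x. ((\<lambda>x. p x $ j) has_derivative (\<lambda>h. \<Sum>i\<in>UNIV. h $ i * g j i x)) (at x)"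
    by (rule grad_closedE[OF gc, of p]) (use p in \<open>auto simp: trig_field_def\<close>)
  obtain h where h: "\<And>j i. h j i \<in> ?T"
    "\<And>j x. ((\<lambda>x. q x $ j) has_derivative (\<lambda>d. \<Sum>i\<in>UNIV. d $ i * h j i x)) (at x)"
    by (rule grad_closedE[OF gc, of q]) (use q in \<open>auto simp: trig_field_def\<close>)
  have pT: "(\<lambda>x. p x $ j) \<in> ?T" and qT: "(\<lambda>x. q x $ j) \<in> ?T" for j
    using p q by (auto simp: trig_field_def)
  have int: "integrable ?M f" if "f \<in> ?T" for f
    using continuous_on_trig[OF that] by (rule integrable_cube_continuous)
  have ig [simp]: "integrable ?M (\<lambda>x. g j i x * q x $ k)"
    and ih [simp]: "integrable ?M (\<lambda>x. p x $ j * h k i x)" for i j k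
    by (intro int trig_mult g(1) h(1) pT qT)+
  have A: "(LINT x|?M. g j i x * q x $ k) = - (LINT x|?M. p x $ j * h k i x)" for i j k
  proof -
    \<comment> \<open>Integration by parts: the product is again a trigonometric polynomial, so it
      has a gradient \<open>r\<close> of mean zero, and uniqueness of gradients identifies
      \<open>r\<close> with the expression from the product rule.\<close>
    obtain r where r: "\<And>i. r i \<in> ?T"
        "\<And>x. ((\<lambda>x. p x $ j * q x $ k) has_derivative (\<lambda>d. \<Sum>i\<in>UNIV. d $ i * r i x)) (at x)"
        "\<And>i. (LINT x|?M. r i x) = 0"
      using trig_gradient[OF L trig_mult[OF pT qT] subset_refl, of j k] by (elim exE conjE) (rule that, auto)
    have "((\<lambda>x. p x $ j * q x $ k) has_derivative
        (\<lambda>d. \<Sum>i\<in>UNIV. d $ i * (p x $ j * h k i x + g j i x * q x $ k))) (at x)" for x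
      using has_derivative_mult[OF g(2)[of j x] h(2)[of k x]]
      by (simp add: sum.distrib algebra_simps sum_distrib_left sum_distrib_right)
    then have "r i x = p x $ j * h k i x + g j i x * q x $ k" for x
      by (rule gradient_unique[OF r(2)])
    then have "r i = (\<lambda>x. p x $ j * h k i x + g j i x * q x $ k)" by blast
    with r(3)[of i] show ?thesis by simp
  qed
  have "L2_inner L (curl p) q = (LINT x|?M. (g 3 2 x * q x $ 1 - g 2 3 x * q x $ 1)
      + (g 1 3 x * q x $ 2 - g 3 1 x * q x $ 2) + (g 2 1 x * q x $ 3 - g 1 2 x * q x $ 3))"
    by (simp add: L2_inner_def curl_components[OF g(2)] inner_vec_def sum_3 left_diff_distrib)
  also have "\<dots> = (LINT x|?M. (p x $ 1 * h 3 2 x - p x $ 1 * h 2 3 x)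
      + (p x $ 2 * h 1 3 x - p x $ 2 * h 3 1 x) + (p x $ 3 * h 2 1 x - p x $ 3 * h 1 2 x))"
    by (simp add: A)
  also have "\<dots> = L2_inner L p (curl q)"
    by (simp add: L2_inner_def curl_components[OF h(2)] inner_vec_def sum_3 right_diff_distrib)
  finally show ?thesis .
qed

section \<open>Density of trigonometric fields\<close>

text \<open>The map \<open>x \<mapsto> (cos (2 \<pi> x\<^sub>i / L), sin (2 \<pi> x\<^sub>i / L))\<^sub>i\<close> identifies opposite faces of the cube;
  the Stone--Weierstrass theorem applies on its image.\<close>

definition torus_map :: "real \<Rightarrow> real^3 \<Rightarrow> (real^3) \<times> (real^3)" where
  "torus_map L x = (\<chi> i. cos (2 * pi / L * x $ i), \<chi> i. sin (2 * pi / L * x $ i))"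

lemma mem_cube: "x \<in> cube L \<longleftrightarrow> (\<forall>i. 0 \<le> x $ i \<and> x $ i \<le> L)"
  by (simp add: cube_def mem_box_cart)

lemma compact_cube: "compact (cube L)"
  by (simp add: cube_def)

text \<open>Equal images force coordinates to differ by an integer multiple of \<open>L\<close>.
  Inside a cube of side \<open>L\<close> a nonzero multiple can only be \<open>L\<close> or
  \<open>- L\<close>, so the points lie on opposite faces.\<close>

lemma torus_map_eq:
  assumes "L > 0" "x \<in> cube L" "y \<in> cube L" "torus_map L x = torus_map L y" "x $ i \<noteq> y $ i"
  shows "x $ i \<in> {0, L} \<and> y $ i \<in> {0, L}"
proof -
  have "sin (2 * pi / L * x $ i) = sin (2 * pi / L * y $ i) \<and> cos (2 * pi / L * x $ i) = cos (2 * pi / L * y $ i)"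
    using assms(4) by (auto simp: torus_map_def vec_eq_iff)
  then obtain n :: int where n: "2 * pi / L * x $ i = 2 * pi / L * y $ i + 2 * pi * n"
    by (subst (asm) sin_cos_eq_iff) blast
  have "2 * pi * (x $ i) = 2 * pi * (y $ i + L * n)"
    using n assms(1) by (simp add: field_simps)
  then have eq: "x $ i = y $ i + L * n"
    by simp
  have "\<bar>L * n\<bar> \<le> L"
    using eq assms(2,3) by (auto simp: mem_cube abs_le_iff dest!: spec[of _ i])
  then have "\<bar>real_of_int n\<bar> \<le> 1"
    using assms(1) by (simp add: abs_mult)
  moreover have "n \<noteq> 0" using eq assms(5) by auto
  ultimately have "n = 1 \<or> n = -1" by linarith
  then show ?thesis
    using eq assms(2,3) by (auto simp: mem_cube dest!: spec[of _ i])
qed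

text \<open>Vanishing on the faces makes \<open>g\<close> factor through the torus map, because
  distinct points with the same image lie on faces. The factor \<open>G\<close> may thus be defined
  through an arbitrary preimage.\<close>

lemma trig_dense_continuous:
  fixes g :: "real^3 \<Rightarrow> real"
  assumes L: "L > 0" and g: "continuous_on (cube L) g"
    and bd: "\<And>x i. x \<in> cube L \<Longrightarrow> x $ i \<in> {0, L} \<Longrightarrow> g x = 0" and e: "e > 0"
  shows "\<exists>f\<in>trig L int_freqs. \<forall>x\<in>cube L. \<bar>g x - f x\<bar> < e"
proof -
  let ?E = "torus_map L" and ?S = "torus_map L ` cube L"
  have E: "continuous_on (cube L) ?E"
    unfolding torus_map_def by (intro continuous_intros)
  define G where "G = (\<lambda>y. g (inv_into (cube L) ?E y))"
  have GE: "G (?E x) = g x" if x: "x \<in> cube L" for x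
  proof -
    let ?y = "inv_into (cube L) ?E (?E x)"
    have y: "?y \<in> cube L" "?E ?y = ?E x"
      using x by (auto intro: inv_into_into f_inv_into_f)
    show ?thesis
    proof (cases "?y = x")
      case False
      then obtain i where "?y $ i \<noteq> x $ i" by (auto simp: vec_eq_iff)
      from torus_map_eq[OF L y(1) x y(2) this] show ?thesis
        using bd[OF y(1), of i] bd[OF x, of i] by (auto simp: G_def)
    qed (simp add: G_def)
  qed
  \<comment> \<open>The graph of \<open>G\<close> is the image of the compact cube under a
    continuous map, hence closed; this replaces an argument with quotient topologies.\<close>
  have G: "continuous_on ?S G"
  proof (rule continuous_from_closed_graph)
    show "compact (g ` cube L)"
      by (intro compact_continuous_image g compact_cube)
    show "G \<in> ?S \<rightarrow> g ` cube L"
      using GE by auto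
    have "(\<lambda>y. (y, G y)) ` ?S = (\<lambda>x. (?E x, g x)) ` cube L"
      using GE by (auto simp: image_image intro!: image_cong)
    also have "closed \<dots>"
      by (intro compact_imp_closed compact_continuous_image continuous_on_Pair E g compact_cube)
    finally show "closed ((\<lambda>y. (y, G y)) ` ?S)" .
  qed
  \<comment> \<open>The ring consists of the continuous functions on the image whose pullbacks are
    trigonometric polynomials. The coordinates of the image belong to it and separate
    points.\<close>
  interpret function_ring_on "{h. continuous_on ?S h \<and> (\<lambda>x. h (?E x)) \<in> trig L int_freqs}" ?S
  proof
    show "compact ?S"
      by (intro compact_continuous_image E compact_cube)
  next
    fix x y assume xy: "x \<in> ?S" "y \<in> ?S" "x \<noteq> y"
    have c: "(\<lambda>y. fst y $ i) \<in> {h. continuous_on ?S h \<and> (\<lambda>x. h (?E x)) \<in> trig L int_freqs}" for i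
      using trig_wave[OF int_freqs_closed(4), of 1 L i 0]
      by (auto intro!: continuous_intros simp: torus_map_def wave_def inner_axis' )
    \<comment> \<open>The sine is the wave with phase -pi/2.\<close>
    have s: "(\<lambda>y. snd y $ i) \<in> {h. continuous_on ?S h \<and> (\<lambda>x. h (?E x)) \<in> trig L int_freqs}" for i
      using trig_wave[OF int_freqs_closed(4), of 1 L i "- pi / 2"]
      by (auto intro!: continuous_intros simp: torus_map_def wave_def inner_axis' cos_diff)
    have "\<exists>i. fst x $ i \<noteq> fst y $ i \<or> snd x $ i \<noteq> snd y $ i"
      using xy(3) by (auto simp: prod_eq_iff vec_eq_iff)
    then obtain i where "fst x $ i \<noteq> fst y $ i \<or> snd x $ i \<noteq> snd y $ i" ..
    then show "\<exists>f\<in>{h. continuous_on ?S h \<and> (\<lambda>x. h (?E x)) \<in> trig L int_freqs}. f x \<noteq> f y"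
      by (elim disjE) (rule bexI[OF _ c[of i]], assumption, rule bexI[OF _ s[of i]], assumption)
  qed (auto intro: continuous_intros trig_add trig_mult trig_const)
  from Stone_Weierstrass_basic[OF G e]
  obtain h where h: "(\<lambda>x. h (?E x)) \<in> trig L int_freqs" "\<And>y. y \<in> ?S \<Longrightarrow> \<bar>G y - h y\<bar> < e"
    by blast
  show ?thesis
    using h(2)[OF imageI] GE by (intro bexI[OF _ h(1)]) auto
qed

section \<open>From square integrable fields to continuous and then trigonometric fields\<close>

lemma L2_dominated_convergence:
  assumes u: "\<And>n. u n \<in> borel_measurable (lebesgue_on (cube L))"
    and v: "v \<in> borel_measurable (lebesgue_on (cube L))"
    and lim: "AE x in lebesgue_on (cube L). (\<lambda>n. u n x) \<longlonglongrightarrow> v x"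
    and w: "integrable (lebesgue_on (cube L)) w"
    and bound: "\<And>n. AE x in lebesgue_on (cube L). (norm (v x - u n x))\<^sup>2 \<le> w x"
  shows "(\<lambda>n. L2_norm L (\<lambda>x. v x - u n x)) \<longlonglongrightarrow> 0"
proof -
  have "(\<lambda>n. LINT x|lebesgue_on (cube L). (norm (v x - u n x))\<^sup>2) \<longlonglongrightarrow> (LINT x|lebesgue_on (cube L). 0)"
  proof (rule integral_dominated_convergence[where w = w])
    show "(\<lambda>x. (norm (v x - u n x))\<^sup>2) \<in> borel_measurable (lebesgue_on (cube L))" for n
      using u[of n] v by (intro borel_measurable_power measurable_compose[OF _ borel_measurable_norm] borel_measurable_diff)
    show "AE x in lebesgue_on (cube L). (\<lambda>n. (norm (v x - u n x))\<^sup>2) \<longlonglongrightarrow> 0"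
      using lim
    proof eventually_elim
      case (elim x)
      from tendsto_power[OF tendsto_norm[OF tendsto_diff[OF tendsto_const[of "v x"] elim]], of 2]
      show ?case by simp
    qed
    show "AE x in lebesgue_on (cube L). norm ((norm (v x - u n x))\<^sup>2) \<le> w x" for n
      using bound by simp
  qed (use w in auto)
  from tendsto_real_sqrt[OF this] show ?thesis by (simp add: L2_norm_def)
qed

lemma AE_in_box: "AE x in lebesgue_on (cube L). x \<in> box 0 (\<chi> i. L)"
proof -
  have "negligible (cbox 0 (\<chi> i. L) - box 0 (\<chi> i. L :: real^3))" by (rule negligible_frontier_interval)
  then have "AE x in lebesgue. x \<notin> cbox 0 (\<chi> i. L) - box 0 (\<chi> i. L :: real^3)"
    unfolding negligible_iff_null_sets by (rule AE_not_in)
  then have "AE x in lebesgue. x \<in> cube L \<longrightarrow> x \<in> box 0 (\<chi> i. L)"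
    by eventually_elim (auto simp: cube_def)
  then show ?thesis
    by (subst AE_restrict_space_iff) (simp_all add: cube_def)
qed

text \<open>In particular such a field is zero on the faces, as \<open>trig_dense_continuous\<close>
  requires of its components.\<close>

definition zero_near_faces :: "real \<Rightarrow> field \<Rightarrow> bool" where
  "zero_near_faces L u \<longleftrightarrow> continuous_on UNIV u \<and> (\<forall>x. x \<notin> box 0 (\<chi> i. L) \<longrightarrow> u x = 0)"

text \<open>Measurability gives continuous fields that converge almost everywhere. A cut-off and a
  truncation provide the boundary values and a constant bound for dominated convergence, without
  changing the limit inside the box.\<close>

lemma L2_approx_bounded:
  assumes v: "v \<in> borel_measurable (lebesgue_on (cube L))" and B: "\<And>x. norm (v x) \<le> B" and e: "e > 0"
  shows "\<exists>u. zero_near_faces L u \<and> L2_norm L (\<lambda>x. v x - u x) < e"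
proof -
  let ?I = "box 0 (\<chi> i. L) :: (real^3) set"
  have "v measurable_on (cube L)"
    using v by (subst measurable_on_iff_borel_measurable) (simp_all add: cube_def)
  then obtain N g where N: "negligible N" and gc: "\<And>n. continuous_on UNIV (g n)"
    and lim: "\<And>x. x \<notin> N \<Longrightarrow> (\<lambda>n. g n x) \<longlonglongrightarrow> (if x \<in> cube L then v x else 0)"
    unfolding measurable_on_def by blast
  have B0: "B \<ge> 0" using order_trans[OF norm_ge_zero B] .
  \<comment> \<open>Zero outside the open box; at each point inside it equals 1 from some
    \<open>n\<close> on.\<close>
  define cut where "cut = (\<lambda>n x. min 1 (real n * infdist x (- ?I)))"
  \<comment> \<open>Truncates every component to [-B, B]. This fixes the values of \<open>v\<close>,
    whose components are bounded by its norm.\<close>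
  define c where "c = (\<lambda>y::real^3. \<chi> j. max (- B) (min B (y $ j)))"
  define u where "u = (\<lambda>n x. cut n x *\<^sub>R c (g n x))"
  have ucont: "continuous_on UNIV (u n)" for n
    unfolding u_def cut_def c_def by (intro continuous_intros gc)
  have uz: "u n x = 0" if "x \<notin> ?I" for n x
    using that by (simp add: u_def cut_def)
  \<comment> \<open>The 3 comes from bounding a norm by the sum of three components; adding the
    bound \<open>B\<close> of \<open>v\<close> gives the \<open>4 * B\<close> below.\<close>
  have cb: "norm (c y) \<le> 3 * B" for y
  proof -
    have "norm (c y) \<le> (\<Sum>j\<in>UNIV. \<bar>c y $ j\<bar>)" by (rule norm_le_l1_cart)
    also have "\<dots> \<le> (\<Sum>j\<in>(UNIV::3 set). B)"
      using B0 by (intro sum_mono) (auto simp: c_def)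
    finally show ?thesis by simp
  qed
  have ub: "norm (u n x) \<le> 3 * B" for n x
  proof -
    have "0 \<le> cut n x" "cut n x \<le> 1" by (auto simp: cut_def infdist_nonneg)
    then have "norm (u n x) \<le> 1 * (3 * B)"
      unfolding u_def norm_scaleR using cb[of "g n x"] by (intro mult_mono) auto
    then show ?thesis by simp
  qed
  have "(\<lambda>n. L2_norm L (\<lambda>x. v x - u n x)) \<longlonglongrightarrow> 0"
  proof (rule L2_dominated_convergence[where w = "\<lambda>x. (4 * B)\<^sup>2"])
    show "u n \<in> borel_measurable (lebesgue_on (cube L))" for n
      using L2_fieldD(1)[OF L2_field_continuous[OF ucont]] .
    show "integrable (lebesgue_on (cube L)) (\<lambda>x. (4 * B)\<^sup>2)"
      by (rule integrable_cube_continuous) simp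
    show "AE x in lebesgue_on (cube L). (norm (v x - u n x))\<^sup>2 \<le> (4 * B)\<^sup>2" for n
    proof (rule AE_I2)
      fix x
      have "norm (v x - u n x) \<le> norm (v x) + norm (u n x)" by (rule norm_triangle_ineq4)
      also have "\<dots> \<le> 4 * B" using B[of x] ub[of n x] by simp
      finally show "(norm (v x - u n x))\<^sup>2 \<le> (4 * B)\<^sup>2" by (intro power_mono) auto
    qed
    have "AE x in lebesgue. x \<notin> N"
      using N by (simp add: negligible_iff_null_sets AE_not_in)
    then have "AE x in lebesgue_on (cube L). x \<notin> N"
      by (subst AE_restrict_space_iff) (auto simp: cube_def)
    with AE_in_box show "AE x in lebesgue_on (cube L). (\<lambda>n. u n x) \<longlonglongrightarrow> v x"
    proof eventually_elim
      case (elim x)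
      have "x \<in> cube L" using elim(1) box_subset_cbox by (auto simp: cube_def)
      with lim[OF elim(2)] have gl: "(\<lambda>n. g n x) \<longlonglongrightarrow> v x" by simp
      have "(\<lambda>n. c (g n x)) \<longlonglongrightarrow> c (v x)"
        unfolding c_def by (intro tendsto_intros gl)
      moreover have "c (v x) = v x"
      proof -
        have "max (- B) (min B (v x $ j)) = v x $ j" for j
          using component_le_norm_cart[of "v x" j] B[of x] by linarith
        then show ?thesis by (simp add: c_def vec_eq_iff)
      qed
      moreover have "(\<lambda>n. cut n x) \<longlonglongrightarrow> 1"
      proof -
        \<comment> \<open>\<open>infdist\<close> to the empty set is 0 by convention, so a positive
          distance needs a nonempty complement.\<close>
        have ne: "- ?I \<noteq> {}"
          using bounded_box[of "0::real^3" "\<chi> i. L"] not_bounded_UNIV by (metis Compl_UNIV_eq double_compl)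
        then have "infdist x (- ?I) > 0"
          using elim(1) by (intro infdist_pos_not_in_closed) (auto simp: closed_Compl)
        then obtain m where m: "1 \<le> real m * infdist x (- ?I)"
          by (meson less_imp_le reals_Archimedean3)
        have "cut n x = 1" if "n \<ge> m" for n
        proof -
          have "real m * infdist x (- ?I) \<le> real n * infdist x (- ?I)"
            using that by (intro mult_right_mono) (auto simp: infdist_nonneg)
          with m show ?thesis by (simp add: cut_def)
        qed
        then show ?thesis
          by (intro tendsto_eventually) (auto simp: eventually_sequentially)
      qed
      ultimately show ?case
        unfolding u_def using tendsto_scaleR by fastforce
    qed
  qed (rule v)
  then have "\<forall>\<^sub>F n in sequentially. L2_norm L (\<lambda>x. v x - u n x) < e"
    using e by (rule order_tendstoD)
  then obtain n where "L2_norm L (\<lambda>x. v x - u n x) < e"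
    by (auto simp: eventually_sequentially)
  then show ?thesis
    using ucont uz by (auto simp: zero_near_faces_def)
qed

lemma L2_approx:
  assumes v: "L2_field L v" and e: "e > 0"
  shows "\<exists>u. zero_near_faces L u \<and> L2_norm L (\<lambda>x. v x - u x) < e"
proof -
  note [measurable] = L2_fieldD(1)[OF v]
  \<comment> \<open>Discarding the values of norm above \<open>n\<close> leaves an error that is
    dominated by \<open>v\<close> itself.\<close>
  define w where "w = (\<lambda>(n::nat) x. if norm (v x) \<le> real n then v x else 0)"
  have wm: "w n \<in> borel_measurable (lebesgue_on (cube L))" for n
    unfolding w_def by measurable
  have "(\<lambda>n. L2_norm L (\<lambda>x. v x - w n x)) \<longlonglongrightarrow> 0"
  proof (rule L2_dominated_convergence[OF wm L2_fieldD(1)[OF v] _ L2_fieldD(2)[OF v]])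
    show "AE x in lebesgue_on (cube L). (\<lambda>n. w n x) \<longlonglongrightarrow> v x"
    proof (rule AE_I2, rule tendsto_eventually)
      fix x
      obtain m :: nat where "norm (v x) \<le> real m" using real_arch_simple by blast
      then show "\<forall>\<^sub>F n in sequentially. w n x = v x"
        unfolding eventually_sequentially w_def by (intro exI[of _ m]) auto
    qed
    show "AE x in lebesgue_on (cube L). (norm (v x - w n x))\<^sup>2 \<le> (norm (v x))\<^sup>2" for n
      by (auto simp: w_def)
  qed
  then have "\<forall>\<^sub>F n in sequentially. L2_norm L (\<lambda>x. v x - w n x) < e / 2"
    using e by (intro order_tendstoD) auto
  then obtain n where n: "L2_norm L (\<lambda>x. v x - w n x) < e / 2"
    by (auto simp: eventually_sequentially)
  have "norm (w n x) \<le> real n" for x by (simp add: w_def)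
  from L2_approx_bounded[OF wm this, of "e / 2"] e obtain u where
    u: "zero_near_faces L u" "L2_norm L (\<lambda>x. w n x - u x) < e / 2" by auto
  have Lu: "L2_field L u" using u(1) by (auto simp: zero_near_faces_def intro: L2_field_continuous)
  have Lw: "L2_field L (w n)"
    unfolding L2_field_def
  proof
    show "integrable (lebesgue_on (cube L)) (\<lambda>x. (norm (w n x))\<^sup>2)"
    proof (rule Bochner_Integration.integrable_bound[OF L2_fieldD(2)[OF v]])
      show "(\<lambda>x. (norm (w n x))\<^sup>2) \<in> borel_measurable (lebesgue_on (cube L))"
        unfolding w_def by measurable
    qed (auto simp: w_def)
  qed (rule wm)
  show ?thesis
    using L2_norm_triangle_diff[OF v Lw Lu] n u by (intro exI[of _ u]) auto
qed

lemma trig_field_dense: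
  assumes L: "L > 0" and v: "L2_field L v" and e: "e > 0"
  shows "\<exists>K p. finite K \<and> K \<subseteq> int_freqs \<and> p \<in> trig_field L K \<and> L2_norm L (\<lambda>x. v x - p x) < e"
proof -
  obtain u where u: "zero_near_faces L u" "L2_norm L (\<lambda>x. v x - u x) < e / 2"
    using L2_approx[OF v, of "e / 2"] e by auto
  have uc: "continuous_on UNIV u" and ub: "\<And>x. x \<notin> box 0 (\<chi> i. L) \<Longrightarrow> u x = 0"
    using u(1) by (auto simp: zero_near_faces_def)
  define V where "V = measure (lebesgue_on (cube L)) (cube L)"
  have V0: "V \<ge> 0" by (simp add: V_def)
  \<comment> \<open>Three components with error \<open>d\<close> each give an L2 error of at most
    \<open>3 * d * sqrt V\<close>, which this choice keeps below \<open>e / 2\<close>. The 1 covers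
    \<open>V = 0\<close> and makes the inequality strict.\<close>
  define d where "d = e / (6 * (sqrt V + 1))"
  have d: "d > 0" using e V0 by (simp add: d_def add_nonneg_pos)
  have "\<exists>f\<in>trig L int_freqs. \<forall>x\<in>cube L. \<bar>u x $ j - f x\<bar> < d" for j
  proof (rule trig_dense_continuous[OF L _ _ d])
    show "continuous_on (cube L) (\<lambda>x. u x $ j)"
      by (intro continuous_intros continuous_on_subset[OF uc]) auto
    fix x i assume "x \<in> cube L" "x $ i \<in> {0, L}"
    then have "x \<notin> box 0 (\<chi> i. L)" by (auto simp: mem_box_cart intro!: exI[of _ i])
    then show "u x $ j = 0" using ub by simp
  qed
  then obtain f where f: "\<And>j. f j \<in> trig L int_freqs" "\<And>j x. x \<in> cube L \<Longrightarrow> \<bar>u x $ j - f j x\<bar> < d"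
    by metis
  define p where "p = (\<lambda>x. \<chi> j. f j x)"
  obtain K where K: "\<And>j. finite (K j)" "\<And>j. K j \<subseteq> int_freqs" "\<And>j. f j \<in> trig L (K j)"
    using trig_finite[OF f(1)] by metis
  have p: "p \<in> trig_field L (\<Union>j. K j)"
    using K(3) by (auto simp: trig_field_def p_def intro: trig_mono)
  have Lp: "L2_field L p" and Lu: "L2_field L u"
    by (rule trig_field_L2[OF p], rule L2_field_continuous[OF uc])
  have "norm (u x - p x) \<le> 3 * d" if "x \<in> cube L" for x
  proof -
    have "norm (u x - p x) \<le> (\<Sum>j\<in>UNIV. \<bar>(u x - p x) $ j\<bar>)" by (rule norm_le_l1_cart)
    also have "\<dots> \<le> (\<Sum>j\<in>(UNIV::3 set). d)"
      using f(2)[OF that] by (intro sum_mono) (auto simp: p_def less_imp_le)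
    finally show ?thesis by simp
  qed
  then have "(LINT x|lebesgue_on (cube L). (norm (u x - p x))\<^sup>2) \<le> (LINT x|lebesgue_on (cube L). (3 * d)\<^sup>2)"
    using L2_fieldD(2)[OF L2_field_diff[OF Lu Lp]]
    by (intro integral_mono power_mono) (auto intro: integrable_cube_continuous)
  also have "\<dots> = (3 * d)\<^sup>2 * V" by (simp add: V_def)
  finally have "L2_norm L (\<lambda>x. u x - p x) \<le> sqrt ((3 * d)\<^sup>2 * V)"
    unfolding L2_norm_def by (rule real_sqrt_le_mono)
  also have "\<dots> = 3 * d * sqrt V" using d by (simp add: real_sqrt_mult)
  also have "\<dots> < e / 2"
  proof -
    have "e * sqrt V < e * (sqrt V + 1)" using e by simp
    moreover have "sqrt V + 1 > 0" using V0 by (simp add: add_nonneg_pos)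
    ultimately show ?thesis by (simp add: d_def field_simps)
  qed
  finally have "L2_norm L (\<lambda>x. v x - p x) < e"
    using L2_norm_triangle_diff[OF v Lu Lp] u(2) by linarith
  then show ?thesis
    using p K by (intro exI[of _ "\<Union>j. K j"] exI[of _ p]) auto
qed

section \<open>The periodic curl space\<close>

text \<open>By the addition theorem two phases span all others, so finite \<open>K\<close> gives a
  finite spanning set. It may be linearly dependent, for instance if \<open>K\<close> contains
  \<open>k\<close> and \<open>- k\<close>; \<open>L2_projection\<close> tolerates this.\<close>

definition trig_basis :: "(real^3) set \<Rightarrow> real \<Rightarrow> field set" where
  "trig_basis K L = (\<lambda>(k, \<theta>, j) x. wave L k \<theta> x *\<^sub>R axis j 1) ` (K \<times> {0, pi / 2} \<times> UNIV)"

lemma trig_basis_subset: "trig_basis K L \<subseteq> trig_field L K"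
  using trig_wave[of _ K 1 L] trig.zero[of L K]
  by (auto simp: trig_basis_def trig_field_def axis_def)

lemma wave_eq: "wave L k \<theta> x = cos \<theta> * wave L k 0 x + sin \<theta> * wave L k (pi / 2) x"
  by (simp add: wave_def cos_add algebra_simps)

text \<open>Orthogonality passes from the spanning set to its span: the addition theorem covers a
  wave of any phase, induction a scalar polynomial, and the three components are added up.\<close>

lemma orthogonal_trig_basis:
  assumes d: "L2_field L d" and o: "\<And>b. b \<in> trig_basis K L \<Longrightarrow> L2_inner L d b = 0"
    and v: "v \<in> trig_field L K"
  shows "L2_inner L d v = 0"
proof -
  have w: "L2_inner L d (\<lambda>x. wave L k \<theta> x *\<^sub>R axis j 1) = 0" if "k \<in> K" for k \<theta> j
  proof -
    have b: "(\<lambda>x. wave L k \<eta> x *\<^sub>R axis j 1) \<in> trig_basis K L" if "\<eta> \<in> {0, pi / 2}" for \<eta>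
      unfolding trig_basis_def using that \<open>k \<in> K\<close>
      by (intro image_eqI[of _ _ "(k, \<eta>, j)"]) auto
    have Lb: "L2_field L (\<lambda>x. wave L k \<eta> x *\<^sub>R axis j 1)" for \<eta>
      by (intro L2_field_continuous continuous_intros continuous_on_wave)
    have eq: "(\<lambda>x. wave L k \<theta> x *\<^sub>R axis j 1 :: real^3)
      = (\<lambda>x. cos \<theta> *\<^sub>R (wave L k 0 x *\<^sub>R axis j 1) + sin \<theta> *\<^sub>R (wave L k (pi / 2) x *\<^sub>R axis j 1))"
      by (subst wave_eq) (simp add: scaleR_add_left)
    show ?thesis
      unfolding eq using o[OF b[of 0]] o[OF b[of "pi / 2"]] d Lb
      by (simp add: L2_inner_linear del: scaleR_scaleR)
  qed
  have c: "L2_inner L d (\<lambda>x. f x *\<^sub>R axis j 1) = 0" if "f \<in> trig L K" for f j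
    using that
  proof induction
    case zero
    then show ?case by simp
  next
    case (wave f k a \<theta>)
    have Lf: "L2_field L (\<lambda>x. f x *\<^sub>R axis j 1)"
      by (intro L2_field_continuous continuous_intros continuous_on_trig[OF wave(1)])
    have Lb: "L2_field L (\<lambda>x. wave L k \<theta> x *\<^sub>R axis j 1)"
      by (intro L2_field_continuous continuous_intros continuous_on_wave)
    have eq: "(\<lambda>x. (f x + a * wave L k \<theta> x) *\<^sub>R axis j 1 :: real^3)
        = (\<lambda>x. f x *\<^sub>R axis j 1 + a *\<^sub>R (wave L k \<theta> x *\<^sub>R axis j 1))"
      by (simp add: scaleR_add_left)
    show ?case
      unfolding eq using wave w[OF wave(2)] d Lf Lb
      by (simp add: L2_inner_linear del: scaleR_scaleR)
  qed
  have vj: "(\<lambda>x. v x $ j) \<in> trig L K" for j using v by (auto simp: trig_field_def)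
  have Lj: "L2_field L (\<lambda>x. (v x $ j) *\<^sub>R axis j 1)" for j
    by (intro L2_field_continuous continuous_intros continuous_on_trig[OF vj])
  have "v = (\<lambda>x. (v x $ 1) *\<^sub>R axis 1 1 + (v x $ 2) *\<^sub>R axis 2 1 + (v x $ 3) *\<^sub>R axis 3 1)"
    by (auto simp: vec_eq_iff forall_3 axis_def)
  then have "L2_inner L d v
      = L2_inner L d (\<lambda>x. (v x $ 1) *\<^sub>R axis 1 1 + (v x $ 2) *\<^sub>R axis 2 1 + (v x $ 3) *\<^sub>R axis 3 1)"
    by (rule arg_cong)
  also have "\<dots> = 0"
    using d Lj c[OF vj] by (simp add: L2_inner_add_right)
  finally show ?thesis .
qed

text \<open>Minimality is Pythagoras: \<open>p\<close> and \<open>q\<close> differ by a member of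
  the space. It transfers the error of any approximant in the space to the projection.\<close>

lemma trig_projection:
  assumes K: "finite K" and v: "L2_field L v"
  obtains p where "p \<in> trig_field L K" "\<And>q. q \<in> trig_field L K \<Longrightarrow> L2_inner L (\<lambda>x. v x - p x) q = 0"
    "\<And>q. q \<in> trig_field L K \<Longrightarrow> L2_norm L (\<lambda>x. v x - p x) \<le> L2_norm L (\<lambda>x. v x - q x)"
proof -
  have "finite (trig_basis K L)" using K by (simp add: trig_basis_def)
  then have "\<exists>p\<in>trig_field L K. (\<forall>b\<in>trig_basis K L. L2_inner L (\<lambda>x. v x - p x) b = 0) \<and>
      (\<forall>w. L2_field L w \<longrightarrow> (\<forall>b\<in>trig_basis K L. L2_inner L w b = 0) \<longrightarrow> L2_inner L w p = 0)"
    by (rule L2_projection[OF _ trig_basis_subset])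
      (erule trig_field_L2, rule trig_field_zero, erule (1) trig_field_add_scaleR, rule v)
  then obtain p where p: "p \<in> trig_field L K" "\<And>b. b \<in> trig_basis K L \<Longrightarrow> L2_inner L (\<lambda>x. v x - p x) b = 0"
    by (elim bexE conjE) (rule that, assumption, erule bspec)
  have Lp: "L2_field L p" using trig_field_L2[OF p(1)] .
  have o: "L2_inner L (\<lambda>x. v x - p x) q = 0" if "q \<in> trig_field L K" for q
    by (rule orthogonal_trig_basis[OF L2_field_diff[OF v Lp] p(2) that])
  have "L2_norm L (\<lambda>x. v x - p x) \<le> L2_norm L (\<lambda>x. v x - q x)" if q: "q \<in> trig_field L K" for q
  proof (rule power2_le_imp_le)
    define s where "s = (\<lambda>x. p x + (-1) *\<^sub>R q x)"
    have sK: "s \<in> trig_field L K"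
      unfolding s_def by (rule trig_field_add_scaleR[OF p(1) q])
    have Ls: "L2_field L s" using trig_field_L2[OF sK] .
    have "(\<lambda>x. v x - q x) = (\<lambda>x. (v x - p x) + s x)" by (simp add: s_def)
    then have "(L2_norm L (\<lambda>x. v x - q x))\<^sup>2 = L2_inner L (\<lambda>x. (v x - p x) + s x) (\<lambda>x. (v x - p x) + s x)"
      by (simp only: L2_norm_sq)
    also have "\<dots> = (L2_norm L (\<lambda>x. v x - p x))\<^sup>2 + (L2_norm L s)\<^sup>2"
      using o[OF sK] L2_inner_commute[of L s "\<lambda>x. v x - p x"] v Lp Ls L2_field_diff[OF v Lp]
      by (simp add: L2_norm_sq L2_inner_add_left L2_inner_add_right)
    finally show "(L2_norm L (\<lambda>x. v x - p x))\<^sup>2 \<le> (L2_norm L (\<lambda>x. v x - q x))\<^sup>2" by simp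
  qed simp
  with p(1) o show ?thesis by (rule that)
qed

text \<open>The spaces of fields with frequencies in \<open>K\<close> are invariant under the curl, so the orthogonal
  projections onto them commute with the periodic curl: one and the same sequence of projections
  approximates a field and its curl.\<close>

lemma trig_field_dense_curl:
  assumes L: "L > 0" and v: "L2_field L v" and w: "L2_field L w"
    and vw: "\<And>\<phi>. \<phi> \<in> trig_field L int_freqs \<Longrightarrow> L2_inner L w \<phi> = L2_inner L v (curl \<phi>)" and e: "e > 0"
  shows "\<exists>p\<in>trig_field L int_freqs. L2_norm L (\<lambda>x. v x - p x) < e \<and> L2_norm L (\<lambda>x. w x - curl p x) < e"
proof -
  obtain K1 p1 where 1: "finite K1" "K1 \<subseteq> int_freqs" "p1 \<in> trig_field L K1" "L2_norm L (\<lambda>x. v x - p1 x) < e"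
    using trig_field_dense[OF L v e] by blast
  obtain K2 p2 where 2: "finite K2" "K2 \<subseteq> int_freqs" "p2 \<in> trig_field L K2" "L2_norm L (\<lambda>x. w x - p2 x) < e"
    using trig_field_dense[OF L w e] by blast
  \<comment> \<open>The union puts the approximants of \<open>v\<close> and of \<open>w\<close> into
    one space, so projecting onto it is at least as good as either.\<close>
  define K where "K = K1 \<union> K2"
  have K: "finite K" "K \<subseteq> int_freqs" using 1 2 by (auto simp: K_def)
  have p1: "p1 \<in> trig_field L K" and p2: "p2 \<in> trig_field L K"
    using 1(3) 2(3) by (auto simp: K_def intro: trig_field_mono)
  obtain p where p: "p \<in> trig_field L K" "\<And>q. q \<in> trig_field L K \<Longrightarrow> L2_inner L (\<lambda>x. v x - p x) q = 0"
    "\<And>q. q \<in> trig_field L K \<Longrightarrow> L2_norm L (\<lambda>x. v x - p x) \<le> L2_norm L (\<lambda>x. v x - q x)"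
    using trig_projection[OF K(1) v] by blast
  obtain r where r: "r \<in> trig_field L K" "\<And>q. q \<in> trig_field L K \<Longrightarrow> L2_inner L (\<lambda>x. w x - r x) q = 0"
    "\<And>q. q \<in> trig_field L K \<Longrightarrow> L2_norm L (\<lambda>x. w x - r x) \<le> L2_norm L (\<lambda>x. w x - q x)"
    using trig_projection[OF K(1) w] by blast
  have cp: "curl p \<in> trig_field L K" by (rule curl_trig_field[OF L K(2) p(1)])
  \<comment> \<open>Both \<open>d\<close> and \<open>curl d\<close> lie in the space, so Green's
    formula and the two orthogonality relations make \<open>d\<close> orthogonal to itself. Thus
    \<open>curl p\<close> agrees with the projection \<open>r\<close> of \<open>w\<close> up to norm
    zero.\<close>
  define d where "d = (\<lambda>x. r x + (-1) *\<^sub>R curl p x)"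
  have d: "d \<in> trig_field L K" unfolding d_def by (rule trig_field_add_scaleR[OF r(1) cp])
  have cd: "curl d \<in> trig_field L K" by (rule curl_trig_field[OF L K(2) d])
  note L2 = trig_field_L2[OF p(1)] trig_field_L2[OF r(1)] trig_field_L2[OF cp] trig_field_L2[OF d]
    trig_field_L2[OF cd]
  have "L2_inner L (curl p) d = L2_inner L p (curl d)"
    using p(1) d K(2) by (intro trig_field_Green[OF L]) (auto intro: trig_field_mono)
  also have "\<dots> = L2_inner L v (curl d)"
    using p(2)[OF cd] v L2 by (simp add: L2_inner_diff_left)
  also have "\<dots> = L2_inner L w d"
    using vw[OF trig_field_mono[OF d K(2)]] by simp
  also have "\<dots> = L2_inner L r d"
    using r(2)[OF d] w L2 by (simp add: L2_inner_diff_left)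
  finally have "L2_inner L (curl p) d = L2_inner L r d" .
  moreover have "L2_inner L d d = L2_inner L r d - L2_inner L (curl p) d"
    using L2 by (subst (1) d_def) (simp add: L2_inner_diff_left)
  ultimately have "L2_norm L d = 0" by (simp flip: L2_norm_sq)
  then have "L2_norm L (\<lambda>x. r x - curl p x) = 0" by (simp add: d_def)
  then have "L2_norm L (\<lambda>x. w x - curl p x) \<le> L2_norm L (\<lambda>x. w x - r x)"
    using L2_norm_triangle_diff[OF w L2(2,3)] by simp
  then show ?thesis
    using p(3)[OF p1] r(3)[OF p2] 1(4) 2(4) p(1) K(2)
    by (intro bexI[of _ p]) (auto intro: trig_field_mono)
qed

section \<open>Cut-offs and test fields with compact support\<close>

definition box_bump :: "real \<Rightarrow> real \<Rightarrow> real^3 \<Rightarrow> real" where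
  "box_bump L \<delta> x = (\<Prod>i\<in>UNIV. exp_bump 0 (axis i 1 \<bullet> x + (- \<delta>)) * exp_bump 0 (- axis i 1 \<bullet> x + (L - \<delta>)))"

lemma smooth_alg_prod:
  assumes "\<And>i. i \<in> A \<Longrightarrow> f i \<in> smooth_alg"
  shows "(\<lambda>x. \<Prod>i\<in>A. f i x) \<in> smooth_alg"
  using assms by (induction A rule: infinite_finite_induct) (auto intro: smooth_alg.intros)

lemma box_bump_smooth_alg: "box_bump L \<delta> \<in> smooth_alg"
  unfolding box_bump_def[abs_def] by (intro smooth_alg_prod smooth_alg.mult smooth_alg.bump)

lemma box_bump_nonzero_iff: "box_bump L \<delta> x \<noteq> 0 \<longleftrightarrow> (\<forall>i. \<delta> < x $ i \<and> x $ i < L - \<delta>)"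
  by (auto simp: box_bump_def exp_bump_def inner_axis')

lemma trig_smooth_alg:
  assumes "f \<in> trig L K"
  shows "f \<in> smooth_alg"
  using assms
proof induction
  case (wave f k a \<theta>)
  have "wave L k \<theta> = (\<lambda>x. cos ((2 * pi / L) *\<^sub>R k \<bullet> x + \<theta>))"
    by (simp add: wave_def fun_eq_iff)
  then have "wave L k \<theta> \<in> smooth_alg" using smooth_alg.cos by metis
  with wave show ?case by (intro smooth_alg.add smooth_alg.mult smooth_alg.const)
qed (rule smooth_alg.const)

text \<open>The cut-off vanishes outside a closed box with margin \<delta> to the faces, which is a
  compact subset of the interior.\<close>

lemma box_bump_interior_test:
  assumes "\<delta> > 0" "q \<in> trig_field L K"
  shows "(\<lambda>x. box_bump L \<delta> x *\<^sub>R q x) \<in> interior_test L"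
proof -
  have "smooth_field (\<lambda>x. box_bump L \<delta> x *\<^sub>R q x)"
  proof (rule grad_closed_smooth[OF grad_closed_smooth_alg])
    fix j
    have "(\<lambda>x. q x $ j) \<in> smooth_alg"
      using assms(2) by (auto simp: trig_field_def intro: trig_smooth_alg)
    from smooth_alg.mult[OF box_bump_smooth_alg this]
    show "(\<lambda>x. (box_bump L \<delta> x *\<^sub>R q x) $ j) \<in> smooth_alg" by simp
  qed
  moreover have "cbox (\<chi> i. \<delta>) (\<chi> i. L - \<delta>) \<subseteq> interior (cube L)"
  proof
    fix x :: "real^3" assume "x \<in> cbox (\<chi> i. \<delta>) (\<chi> i. L - \<delta>)"
    then have "\<delta> \<le> x $ i" "x $ i \<le> L - \<delta>" for i by (auto simp: mem_box_cart)
    then have "0 < x $ i" "x $ i < L" for i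
      using assms(1) by (metis less_le_trans, smt (verit))
    then show "x \<in> interior (cube L)" by (simp add: cube_def interior_cbox mem_box_cart)
  qed
  moreover have "box_bump L \<delta> x *\<^sub>R q x = 0" if "x \<notin> cbox (\<chi> i. \<delta>) (\<chi> i. L - \<delta>)" for x
    using that box_bump_nonzero_iff[of L \<delta> x] by (auto simp: mem_box_cart less_imp_le)
  ultimately show ?thesis
    unfolding interior_test_def by (blast intro: compact_cbox)
qed

text \<open>Moving the cut-off from the test field to \<open>d\<close> shows that \<open>d\<close>
  times a cut-off is orthogonal to all trigonometric fields, hence zero by their density. Shrinking
  margins exhaust the open box.\<close>

lemma interior_test_separates:
  assumes L: "L > 0" and d: "L2_field L d" and o: "\<And>\<phi>. \<phi> \<in> interior_test L \<Longrightarrow> L2_inner L d \<phi> = 0"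
  shows "AE x in lebesgue_on (cube L). d x = 0"
proof -
  have "AE x in lebesgue_on (cube L). box_bump L \<delta> x *\<^sub>R d x = 0" if "\<delta> > 0" for \<delta>
  proof (rule L2_norm_eq_0_AE)
    let ?d = "\<lambda>x. box_bump L \<delta> x *\<^sub>R d x"
    have "continuous_on UNIV (\<lambda>x. \<chi> j. box_bump L \<delta> x :: real^3)"
      by (intro smooth_field_continuous grad_closed_smooth[OF grad_closed_smooth_alg])
        (simp add: box_bump_smooth_alg)
    then have "continuous_on UNIV (\<lambda>x. (\<chi> j. box_bump L \<delta> x :: real^3) $ 1)"
      by (rule continuous_on_component)
    then have c: "continuous_on UNIV (box_bump L \<delta>)" by simp
    show Ld: "L2_field L ?d"
      by (rule L2_field_mult_bounded[OF d c])
    show "L2_norm L ?d = 0"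
    proof (rule ccontr)
      assume "L2_norm L ?d \<noteq> 0"
      then have pos: "L2_norm L ?d > 0" by (metis L2_norm_nonneg less_eq_real_def)
      from trig_field_dense[OF L Ld pos] obtain K q where
        q: "q \<in> trig_field L K" "L2_norm L (\<lambda>x. ?d x - q x) < L2_norm L ?d"
        by blast
      have Lq: "L2_field L q" by (rule trig_field_L2[OF q(1)])
      have "L2_inner L ?d q = L2_inner L d (\<lambda>x. box_bump L \<delta> x *\<^sub>R q x)"
        by (simp add: L2_inner_def)
      also have "\<dots> = 0" by (rule o[OF box_bump_interior_test[OF that q(1)]])
      \<comment> \<open>Orthogonality to \<open>q\<close> allows subtracting \<open>q\<close> in one
        argument, so Cauchy-Schwarz contradicts that \<open>q\<close> is closer to \<open>?d\<close>
        than 0 is.\<close>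
      finally have "(L2_norm L ?d)\<^sup>2 = L2_inner L ?d (\<lambda>x. ?d x - q x)"
        using Ld Lq by (simp add: L2_norm_sq L2_inner_diff_right)
      also have "\<dots> \<le> L2_norm L ?d * L2_norm L (\<lambda>x. ?d x - q x)"
        using L2_Cauchy_Schwarz[OF Ld L2_field_diff[OF Ld Lq]] by linarith
      also have "\<dots> < L2_norm L ?d * L2_norm L ?d"
        using q(2) pos by (intro mult_strict_left_mono)
      finally show False by (simp add: power2_eq_square)
    qed
  qed
  then have "AE x in lebesgue_on (cube L). \<forall>n. box_bump L (1 / real (Suc n)) x *\<^sub>R d x = 0"
    by (subst AE_all_countable) auto
  with AE_in_box show ?thesis
  proof eventually_elim
    case (elim x)
    have pos: "0 < min (x $ i) (L - x $ i)" for i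
      using elim(1) by (auto simp: mem_box_cart)
    then have "\<forall>i. \<exists>n. 1 / real (Suc n) < min (x $ i) (L - x $ i)"
      using nat_approx_posE by metis
    then obtain N where N: "\<And>i. 1 / real (Suc (N i)) < min (x $ i) (L - x $ i)" by metis
    \<comment> \<open>The sum dominates all three indices, so one margin works in every
      direction.\<close>
    define n where "n = N 1 + N 2 + N 3"
    have "1 / real (Suc n) < min (x $ i) (L - x $ i)" for i
    proof (rule le_less_trans[OF _ N])
      have "N i \<le> n" using exhaust_3[of i] by (auto simp: n_def)
      then show "1 / real (Suc n) \<le> 1 / real (Suc (N i))" by (simp add: field_simps)
    qed
    then have "box_bump L (1 / real (Suc n)) x \<noteq> 0"
      unfolding box_bump_nonzero_iff by (auto simp: less_diff_eq add.commute)
    with elim(2) show ?case by (metis scaleR_eq_0_iff)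
  qed
qed

section \<open>Weak curls and the symmetry of the periodic curl\<close>

lemma has_weak_curl_L2: "has_weak_curl L v w \<Longrightarrow> L2_field L v" "has_weak_curl L v w \<Longrightarrow> L2_field L w"
  by (auto simp: has_weak_curl_def)

lemma Hcurl_per_weak_curl: "v \<in> Hcurl_per L \<Longrightarrow> has_weak_curl L v (wcurl L v)"
  using someI_ex[of "has_weak_curl L v"] by (auto simp: Hcurl_per_def wcurl_def)

lemma Hcurl_per_L2:
  assumes "v \<in> Hcurl_per L"
  shows "L2_field L v" "L2_field L (wcurl L v)"
  using has_weak_curl_L2[OF Hcurl_per_weak_curl[OF assms]] by auto

lemma interior_test_L2:
  assumes "\<phi> \<in> interior_test L"
  shows "L2_field L \<phi>" "L2_field L (curl \<phi>)"
  using assms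
  by (auto simp: interior_test_def intro!: L2_field_continuous smooth_field_continuous continuous_curl)

text \<open>Linearity is expressed for the relation, since the chosen representatives
  \<open>wcurl\<close> need not respect linear combinations pointwise.\<close>

lemma has_weak_curl_lincomb:
  assumes "has_weak_curl L u a" "has_weak_curl L v b"
  shows "has_weak_curl L (\<lambda>x. r *\<^sub>R u x + s *\<^sub>R v x) (\<lambda>x. r *\<^sub>R a x + s *\<^sub>R b x)"
proof -
  note L2 = has_weak_curl_L2[OF assms(1)] has_weak_curl_L2[OF assms(2)]
  have "L2_inner L (\<lambda>x. r *\<^sub>R u x + s *\<^sub>R v x) (curl \<phi>) = L2_inner L (\<lambda>x. r *\<^sub>R a x + s *\<^sub>R b x) \<phi>"
    if "\<phi> \<in> interior_test L" for \<phi>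
    using assms that L2 interior_test_L2[OF that]
    by (simp add: has_weak_curl_def L2_inner_add_left L2_inner_scaleR_left)
  with L2 show ?thesis by (simp add: has_weak_curl_def)
qed

lemma has_weak_curl_unique:
  assumes L: "L > 0" and w: "has_weak_curl L v w" and w': "has_weak_curl L v w'"
  shows "AE x in lebesgue_on (cube L). w x = w' x"
proof -
  have "AE x in lebesgue_on (cube L). w x - w' x = 0"
  proof (rule interior_test_separates[OF L])
    show "L2_field L (\<lambda>x. w x - w' x)"
      using w w' by (auto dest: has_weak_curl_L2)
    show "L2_inner L (\<lambda>x. w x - w' x) \<phi> = 0" if "\<phi> \<in> interior_test L" for \<phi>
      using w w' that interior_test_L2[OF that] by (simp add: has_weak_curl_def L2_inner_diff_left)
  qed
  then show ?thesis by simp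
qed

text \<open>Uniqueness almost everywhere lets the norm of the curl space be computed with any
  convenient weak curl.\<close>

lemma L2_norm_wcurl:
  assumes L: "L > 0" and w: "has_weak_curl L v w"
  shows "L2_norm L (wcurl L v) = L2_norm L w"
proof -
  have "has_weak_curl L v (wcurl L v)"
    using someI[of "has_weak_curl L v", OF w] by (simp add: wcurl_def)
  then show ?thesis
    using w has_weak_curl_unique[OF L _ w] by (intro L2_norm_cong_AE) (auto dest: has_weak_curl_L2)
qed

lemma Hcurl_per_test:
  assumes "v \<in> Hcurl_per L" "\<phi> \<in> periodic_test L"
  shows "L2_inner L (wcurl L v) \<phi> = L2_inner L v (curl \<phi>)"
  using assms by (auto simp: Hcurl_per_def periodic_trace_def)

lemma Hcurl_per_dense:
  assumes L: "L > 0" and v: "v \<in> Hcurl_per L" and e: "e > 0"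
  obtains p where "p \<in> trig_field L int_freqs" "L2_norm L (\<lambda>x. v x - p x) < e"
    "L2_norm L (\<lambda>x. wcurl L v x - curl p x) < e"
proof -
  have "\<exists>p\<in>trig_field L int_freqs. L2_norm L (\<lambda>x. v x - p x) < e \<and> L2_norm L (\<lambda>x. wcurl L v x - curl p x) < e"
    by (rule trig_field_dense_curl[OF L Hcurl_per_L2[OF v] _ e])
      (rule Hcurl_per_test[OF v trig_field_periodic_test[OF L subset_refl]])
  then show ?thesis
    by (elim bexE conjE) (rule that)
qed

lemma le_of_le_add_mult_eps:
  fixes X Y C :: real
  assumes "\<And>\<eta>. \<eta> > 0 \<Longrightarrow> X \<le> Y + C * \<eta>" "C \<ge> 0"
  shows "X \<le> Y"
proof (rule field_le_epsilon)
  fix e :: real assume "e > 0"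
  \<comment> \<open>The 1 in the denominator allows \<open>C = 0\<close>.\<close>
  then have "X \<le> Y + C * (e / (C + 1))"
    using assms(2) by (intro assms(1)) (simp add: add_nonneg_pos)
  also have "C * (e / (C + 1)) \<le> e" using assms(2) \<open>e > 0\<close> by (simp add: field_simps)
  finally show "X \<le> Y + e" by simp
qed

lemma L2_inner_diff_bound:
  assumes "L2_field L u" "L2_field L v" "L2_field L p" "L2_norm L (\<lambda>x. v x - p x) \<le> e"
  shows "\<bar>L2_inner L u v - L2_inner L u p\<bar> \<le> L2_norm L u * e"
proof -
  have "\<bar>L2_inner L u v - L2_inner L u p\<bar> = \<bar>L2_inner L u (\<lambda>x. v x - p x)\<bar>"
    using assms by (simp add: L2_inner_diff_right)
  also have "\<dots> \<le> L2_norm L u * L2_norm L (\<lambda>x. v x - p x)"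
    using assms by (intro L2_Cauchy_Schwarz) auto
  also have "\<dots> \<le> L2_norm L u * e"
    using assms by (intro mult_left_mono) auto
  finally show ?thesis .
qed

text \<open>Only \<open>v\<close> has to be approximated: for a trigonometric field in its place the
  identity is the periodic trace condition on \<open>u\<close>.\<close>

lemma Hcurl_per_Green:
  assumes L: "L > 0" and u: "u \<in> Hcurl_per L" and v: "v \<in> Hcurl_per L"
  shows "L2_inner L (wcurl L u) v = L2_inner L u (wcurl L v)"
proof -
  note Lu = Hcurl_per_L2[OF u] and Lv = Hcurl_per_L2[OF v]
  have "\<bar>L2_inner L (wcurl L u) v - L2_inner L u (wcurl L v)\<bar> \<le> 0"
  proof (rule le_of_le_add_mult_eps)
    fix \<eta> :: real assume "\<eta> > 0"
    then obtain p where p: "p \<in> trig_field L int_freqs" "L2_norm L (\<lambda>x. v x - p x) < \<eta>"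
      "L2_norm L (\<lambda>x. wcurl L v x - curl p x) < \<eta>"
      by (rule Hcurl_per_dense[OF L v])
    have Lp: "L2_field L p" "L2_field L (curl p)"
      using trig_field_L2[OF p(1)] trig_field_L2[OF curl_trig_field[OF L subset_refl p(1)]] by auto
    have "L2_inner L (wcurl L u) p = L2_inner L u (curl p)"
      by (rule Hcurl_per_test[OF u trig_field_periodic_test[OF L subset_refl p(1)]])
    with L2_inner_diff_bound[OF Lu(2) Lv(1) Lp(1) less_imp_le[OF p(2)]]
      L2_inner_diff_bound[OF Lu(1) Lv(2) Lp(2) less_imp_le[OF p(3)]]
    show "\<bar>L2_inner L (wcurl L u) v - L2_inner L u (wcurl L v)\<bar>
        \<le> 0 + (L2_norm L (wcurl L u) + L2_norm L u) * \<eta>"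
      by (simp add: distrib_right)
  qed simp
  then show ?thesis by simp
qed

section \<open>Curves of square integrable fields\<close>

definition L2_cont :: "real \<Rightarrow> (real \<Rightarrow> field) \<Rightarrow> real \<Rightarrow> bool" where
  "L2_cont L u t \<longleftrightarrow> ((\<lambda>s. L2_norm L (\<lambda>x. u s x - u t x)) \<longlongrightarrow> 0) (at t)"

definition L2_deriv :: "real \<Rightarrow> (real \<Rightarrow> field) \<Rightarrow> field \<Rightarrow> real \<Rightarrow> bool" where
  "L2_deriv L u u' t \<longleftrightarrow>
     ((\<lambda>s. L2_norm L (\<lambda>x. (u s x - u t x) /\<^sub>R (s - t) - u' x)) \<longlongrightarrow> 0) (at t)"

lemma eventually_Ioo: "(t::real) \<in> {a<..<b} \<Longrightarrow> \<forall>\<^sub>F s in at t. s \<in> {a<..<b} \<and> s \<noteq> t"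
  using eventually_at_in_open[of "{a<..<b}" t] by simp

lemma L2_norm_tendsto_0I:
  assumes "\<forall>\<^sub>F s in F. L2_norm L (f s) \<le> g s" "(g \<longlongrightarrow> 0) F"
  shows "((\<lambda>s. L2_norm L (f s)) \<longlongrightarrow> 0) F"
  by (rule tendsto_sandwich[OF _ assms(1) tendsto_const assms(2)]) simp

lemma L2_cont_lincomb:
  assumes t: "t \<in> {a<..<b}" and u: "\<And>s. s \<in> {a<..<b} \<Longrightarrow> L2_field L (u s)" "L2_cont L u t"
    and v: "\<And>s. s \<in> {a<..<b} \<Longrightarrow> L2_field L (v s)" "L2_cont L v t"
  shows "L2_cont L (\<lambda>s x. p *\<^sub>R u s x + q *\<^sub>R v s x) t"
  unfolding L2_cont_def
proof (rule L2_norm_tendsto_0I)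
  let ?u = "\<lambda>s. L2_norm L (\<lambda>x. u s x - u t x)" and ?v = "\<lambda>s. L2_norm L (\<lambda>x. v s x - v t x)"
  show "\<forall>\<^sub>F s in at t. L2_norm L (\<lambda>x. (p *\<^sub>R u s x + q *\<^sub>R v s x) - (p *\<^sub>R u t x + q *\<^sub>R v t x))
      \<le> \<bar>p\<bar> * ?u s + \<bar>q\<bar> * ?v s"
    using eventually_Ioo[OF t]
  proof eventually_elim
    case (elim s)
    have "(\<lambda>x. (p *\<^sub>R u s x + q *\<^sub>R v s x) - (p *\<^sub>R u t x + q *\<^sub>R v t x))
        = (\<lambda>x. p *\<^sub>R (u s x - u t x) + q *\<^sub>R (v s x - v t x))"
      by (simp add: algebra_simps)
    then show ?case
      using L2_norm_triangle[of L "\<lambda>x. p *\<^sub>R (u s x - u t x)" "\<lambda>x. q *\<^sub>R (v s x - v t x)"] elim t u(1) v(1)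
      by (simp add: L2_norm_scaleR)
  qed
  show "((\<lambda>s. \<bar>p\<bar> * ?u s + \<bar>q\<bar> * ?v s) \<longlongrightarrow> 0) (at t)"
    using u(2) v(2) by (auto intro!: tendsto_eq_intros simp: L2_cont_def)
qed

lemma L2_deriv_diff:
  assumes t: "t \<in> {a<..<b}"
    and u: "\<And>s. s \<in> {a<..<b} \<Longrightarrow> L2_field L (u s)" "L2_field L u'" "L2_deriv L u u' t"
    and v: "\<And>s. s \<in> {a<..<b} \<Longrightarrow> L2_field L (v s)" "L2_field L v'" "L2_deriv L v v' t"
  shows "L2_deriv L (\<lambda>s x. u s x - v s x) (\<lambda>x. u' x - v' x) t"
  unfolding L2_deriv_def
proof (rule L2_norm_tendsto_0I)
  let ?u = "\<lambda>s x. (u s x - u t x) /\<^sub>R (s - t) - u' x"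
  let ?v = "\<lambda>s x. (v s x - v t x) /\<^sub>R (s - t) - v' x"
  show "\<forall>\<^sub>F s in at t. L2_norm L (\<lambda>x. ((u s x - v s x) - (u t x - v t x)) /\<^sub>R (s - t) - (u' x - v' x))
      \<le> L2_norm L (?u s) + L2_norm L (?v s)"
    using eventually_Ioo[OF t]
  proof eventually_elim
    case (elim s)
    have "(\<lambda>x. ((u s x - v s x) - (u t x - v t x)) /\<^sub>R (s - t) - (u' x - v' x))
        = (\<lambda>x. ?u s x + (-1) *\<^sub>R ?v s x)"
      by (simp add: algebra_simps)
    then show ?case
      using L2_norm_triangle[of L "?u s" "\<lambda>x. (-1) *\<^sub>R ?v s x"] elim t u(1,2) v(1,2)
      by (simp only: L2_norm_scaleR) simp
  qed
  show "((\<lambda>s. L2_norm L (?u s) + L2_norm L (?v s)) \<longlongrightarrow> 0) (at t)"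
    using tendsto_add[OF u(3)[unfolded L2_deriv_def] v(3)[unfolded L2_deriv_def]] by simp
qed

lemma L2_deriv_imp_cont:
  assumes t: "t \<in> {a<..<b}"
    and u: "\<And>s. s \<in> {a<..<b} \<Longrightarrow> L2_field L (u s)" "L2_field L u'" "L2_deriv L u u' t"
  shows "L2_cont L u t"
  unfolding L2_cont_def
proof (rule L2_norm_tendsto_0I)
  let ?q = "\<lambda>s x. (u s x - u t x) /\<^sub>R (s - t) - u' x"
  show "\<forall>\<^sub>F s in at t. L2_norm L (\<lambda>x. u s x - u t x) \<le> \<bar>s - t\<bar> * (L2_norm L (?q s) + L2_norm L u')"
    using eventually_Ioo[OF t]
  proof eventually_elim
    case (elim s)
    have "(\<lambda>x. u s x - u t x) = (\<lambda>x. (s - t) *\<^sub>R (?q s x + u' x))"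
      using elim by simp
    then have "L2_norm L (\<lambda>x. u s x - u t x) = \<bar>s - t\<bar> * L2_norm L (\<lambda>x. ?q s x + u' x)"
      by (simp only: L2_norm_scaleR)
    also have "\<dots> \<le> \<bar>s - t\<bar> * (L2_norm L (?q s) + L2_norm L u')"
      using elim t u(1,2) by (intro mult_left_mono L2_norm_triangle) auto
    finally show ?case .
  qed
  have "((\<lambda>s. \<bar>s - t\<bar> * (L2_norm L (?q s) + L2_norm L u')) \<longlongrightarrow> \<bar>t - t\<bar> * (0 + L2_norm L u')) (at t)"
    by (intro tendsto_intros u(3)[unfolded L2_deriv_def])
  then show "((\<lambda>s. \<bar>s - t\<bar> * (L2_norm L (?q s) + L2_norm L u')) \<longlongrightarrow> 0) (at t)" by simp
qed

lemma L2_cont_inner: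
  assumes t: "t \<in> {a<..<b}" and u: "\<And>s. s \<in> {a<..<b} \<Longrightarrow> L2_field L (u s)" "L2_cont L u t"
    and v: "L2_field L v"
  shows "((\<lambda>s. L2_inner L v (u s)) \<longlongrightarrow> L2_inner L v (u t)) (at t)"
proof (rule LIM_zero_cancel, rule Lim_null_comparison)
  show "\<forall>\<^sub>F s in at t. norm (L2_inner L v (u s) - L2_inner L v (u t))
      \<le> L2_norm L v * L2_norm L (\<lambda>x. u s x - u t x)"
    using eventually_Ioo[OF t]
    by eventually_elim (use L2_inner_diff_bound[OF v u(1) u(1)[OF t] order_refl] in auto)
  show "((\<lambda>s. L2_norm L v * L2_norm L (\<lambda>x. u s x - u t x)) \<longlongrightarrow> 0) (at t)"
    using tendsto_mult_right_zero[OF u(2)[unfolded L2_cont_def]] .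
qed

lemma L2_cont_norm:
  assumes t: "t \<in> {a<..<b}" and u: "\<And>s. s \<in> {a<..<b} \<Longrightarrow> L2_field L (u s)" "L2_cont L u t"
  shows "((\<lambda>s. L2_norm L (u s)) \<longlongrightarrow> L2_norm L (u t)) (at t)"
proof (rule LIM_zero_cancel, rule Lim_null_comparison)
  show "\<forall>\<^sub>F s in at t. norm (L2_norm L (u s) - L2_norm L (u t)) \<le> L2_norm L (\<lambda>x. u s x - u t x)"
    using eventually_Ioo[OF t]
  proof eventually_elim
    case (elim s)
    then have s: "L2_field L (u s)" and t': "L2_field L (u t)" using u(1) t by auto
    show ?case
      using L2_norm_triangle[OF L2_field_diff[OF s t'] t'] L2_norm_triangle[OF L2_field_diff[OF t' s] s]
      by (simp add: L2_norm_minus_commute[of L "u t"])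
  qed
qed (rule u(2)[unfolded L2_cont_def])

text \<open>The difference of squares is (u(s) - u(t), u(s) + u(t)). Replacing the difference
  quotient by \<open>u'\<close> costs the first summand of \<open>?g\<close>, and replacing
  \<open>u s\<close> by \<open>u t\<close> the second.\<close>

lemma L2_norm_sq_has_derivative:
  assumes t: "t \<in> {a<..<b}"
    and u: "\<And>s. s \<in> {a<..<b} \<Longrightarrow> L2_field L (u s)" "L2_field L u'" "L2_deriv L u u' t"
  shows "((\<lambda>s. (L2_norm L (u s))\<^sup>2) has_real_derivative 2 * L2_inner L u' (u t)) (at t)"
  unfolding has_field_derivative_iff
proof (rule LIM_zero_cancel, rule Lim_null_comparison)
  let ?q = "\<lambda>s x. (u s x - u t x) /\<^sub>R (s - t) - u' x"
  let ?g = "\<lambda>s. L2_norm L (?q s) * (L2_norm L (u s) + L2_norm L (u t))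
    + \<bar>L2_inner L u' (u s) - L2_inner L u' (u t)\<bar>"
  note c = L2_deriv_imp_cont[OF t u]
  show "\<forall>\<^sub>F s in at t. norm (((L2_norm L (u s))\<^sup>2 - (L2_norm L (u t))\<^sup>2) / (s - t)
      - 2 * L2_inner L u' (u t)) \<le> ?g s"
    using eventually_Ioo[OF t]
  proof eventually_elim
    case (elim s)
    note L2 = u(1)[OF t] u(1)[OF conjunct1[OF elim]] u(2)
    have Lq: "L2_field L (?q s)" using L2 by simp
    have "L2_inner L (\<lambda>x. (u s x - u t x) /\<^sub>R (s - t)) (\<lambda>x. u s x + u t x)
        = ((L2_norm L (u s))\<^sup>2 - (L2_norm L (u t))\<^sup>2) / (s - t)"
      unfolding L2_inner_scaleR_left using L2
      by (simp add: L2_norm_sq L2_inner_add_right L2_inner_diff_left L2_inner_commute[of L "u t" "u s"]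
          divide_inverse mult.commute)
    moreover have "L2_inner L (?q s) (\<lambda>x. u s x + u t x)
        = L2_inner L (\<lambda>x. (u s x - u t x) /\<^sub>R (s - t)) (\<lambda>x. u s x + u t x)
          - L2_inner L u' (\<lambda>x. u s x + u t x)"
      using L2 by (intro L2_inner_diff_left) auto
    moreover have "L2_inner L u' (\<lambda>x. u s x + u t x) = L2_inner L u' (u s) + L2_inner L u' (u t)"
      using L2 by (intro L2_inner_add_right) auto
    moreover have "\<bar>L2_inner L (?q s) (\<lambda>x. u s x + u t x)\<bar> \<le> L2_norm L (?q s) * (L2_norm L (u s) + L2_norm L (u t))"
      using L2_Cauchy_Schwarz[OF Lq L2_field_add[OF L2(2,1)]]
        mult_left_mono[OF L2_norm_triangle[OF L2(2,1)] L2_norm_nonneg[of L "?q s"]] by linarith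
    ultimately show ?case unfolding real_norm_def by linarith
  qed
  have "(?g \<longlongrightarrow> 0 * (L2_norm L (u t) + L2_norm L (u t)) + \<bar>L2_inner L u' (u t) - L2_inner L u' (u t)\<bar>) (at t)"
    by (intro tendsto_intros u(3)[unfolded L2_deriv_def] L2_cont_norm[OF t u(1) c] L2_cont_inner[OF t u(1) c u(2)])
  then show "(?g \<longlongrightarrow> 0) (at t)" by simp
qed

section \<open>Conservation of the energy\<close>

text \<open>The curl norm dominates the L2 norm of a field and of each of its weak curls. The
  difference quotient of the chosen curls is a weak curl of the difference quotient, so it converges
  in L2 as well.\<close>

lemma C1_Hcurl_perD:
  assumes L: "L > 0" and C1: "C1_Hcurl_per L T u ut" and t: "t \<in> {0<..<T}"
  shows "u t \<in> Hcurl_per L" "ut t \<in> Hcurl_per L"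
    and "L2_deriv L u (ut t) t" "L2_deriv L (\<lambda>s. wcurl L (u s)) (wcurl L (ut t)) t"
    and "L2_cont L ut t" "L2_cont L (\<lambda>s. wcurl L (ut s)) t"
proof -
  have mem: "u s \<in> Hcurl_per L" "ut s \<in> Hcurl_per L" if "s \<in> {0<..<T}" for s
    using C1 that by (auto simp: C1_Hcurl_per_def)
  show "u t \<in> Hcurl_per L" "ut t \<in> Hcurl_per L" using mem[OF t] by auto
  have H: "((\<lambda>s. Hcurl_norm L (\<lambda>x. (u s x - u t x) /\<^sub>R (s - t) - ut t x)) \<longlongrightarrow> 0) (at t)"
    "((\<lambda>s. Hcurl_norm L (\<lambda>x. ut s x - ut t x)) \<longlongrightarrow> 0) (at t)"
    using C1 t by (auto simp: C1_Hcurl_per_def)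
  have le: "L2_norm L v \<le> Hcurl_norm L v" "has_weak_curl L v w \<Longrightarrow> L2_norm L w \<le> Hcurl_norm L v" for v w
    by (auto simp: Hcurl_norm_def L2_norm_wcurl[OF L, symmetric] intro!: real_le_rsqrt)
  show "L2_deriv L u (ut t) t" "L2_cont L ut t"
    unfolding L2_deriv_def L2_cont_def
    by (rule L2_norm_tendsto_0I[OF always_eventually H(1)] L2_norm_tendsto_0I[OF always_eventually H(2)];
        simp add: le)+
  have wd: "has_weak_curl L (\<lambda>x. r *\<^sub>R (v x - v' x)) (\<lambda>x. r *\<^sub>R (wcurl L v x - wcurl L v' x))"
    if "v \<in> Hcurl_per L" "v' \<in> Hcurl_per L" for v v' r
    using has_weak_curl_lincomb[OF that[THEN Hcurl_per_weak_curl], of r "- r"]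
    by (simp add: scaleR_diff_right)
  show "L2_deriv L (\<lambda>s. wcurl L (u s)) (wcurl L (ut t)) t"
    unfolding L2_deriv_def
  proof (rule L2_norm_tendsto_0I[OF _ H(1)])
    show "\<forall>\<^sub>F s in at t. L2_norm L (\<lambda>x. (wcurl L (u s) x - wcurl L (u t) x) /\<^sub>R (s - t) - wcurl L (ut t) x)
        \<le> Hcurl_norm L (\<lambda>x. (u s x - u t x) /\<^sub>R (s - t) - ut t x)"
      using eventually_Ioo[OF t]
    proof eventually_elim
      case (elim s)
      from has_weak_curl_lincomb[OF wd[OF mem(1)[of s] mem(1)[OF t], of "inverse (s - t)"]
          Hcurl_per_weak_curl[OF mem(2)[OF t]], of 1 "-1"] elim
      show ?case by (intro le(2)) simp
    qed
  qed
  show "L2_cont L (\<lambda>s. wcurl L (ut s)) t"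
    unfolding L2_cont_def
  proof (rule L2_norm_tendsto_0I[OF _ H(2)])
    show "\<forall>\<^sub>F s in at t. L2_norm L (\<lambda>x. wcurl L (ut s) x - wcurl L (ut t) x)
        \<le> Hcurl_norm L (\<lambda>x. ut s x - ut t x)"
      using eventually_Ioo[OF t]
    proof eventually_elim
      case (elim s)
      with wd[OF mem(2)[of s] mem(2)[OF t], of 1] show ?case by (intro le(2)) simp
    qed
  qed
qed

text \<open>If the derivative of \<open>A\<close> exists only as a functional on test fields, but is bounded in the
  norm of the curl space and continuous in time, then the mean value theorem bounds the
  error of the difference quotient uniformly in the test field, and by density the test field may
  be taken to be \<open>A\<close> itself.\<close>

lemma L2_norm_sq_has_derivative_dual:
  assumes L: "L > 0" and t: "t \<in> {a<..<b}"
    and A: "\<And>s. s \<in> {a<..<b} \<Longrightarrow> A s \<in> Hcurl_per L" "L2_cont L A t" "L2_cont L (\<lambda>s. wcurl L (A s)) t"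
    and P: "\<And>s. s \<in> {a<..<b} \<Longrightarrow> L2_field L (P s)" "L2_cont L P t"
    and Q: "\<And>s. s \<in> {a<..<b} \<Longrightarrow> L2_field L (Q s)" "L2_cont L Q t"
    and D: "\<And>s \<phi>. s \<in> {a<..<b} \<Longrightarrow> \<phi> \<in> periodic_test L \<Longrightarrow>
      ((\<lambda>r. L2_inner L (A r) \<phi>) has_real_derivative L2_inner L (P s) \<phi> + L2_inner L (Q s) (curl \<phi>)) (at s)"
  shows "((\<lambda>s. (L2_norm L (A s))\<^sup>2) has_real_derivative
      2 * (L2_inner L (P t) (A t) + L2_inner L (Q t) (wcurl L (A t)))) (at t)"
proof -
  \<comment> \<open>\<open>F s\<close> is the derivative functional with the field and its curl as
    separate arguments, so that it also accepts a weak curl; \<open>N\<close> is equivalent to the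
    curl norm.\<close>
  define F where "F = (\<lambda>s v w. L2_inner L (P s) v + L2_inner L (Q s) w)"
  define N where "N = (\<lambda>v w. L2_norm L v + L2_norm L w)"
  note LA = Hcurl_per_L2[OF A(1)]
  \<comment> \<open>One neighbourhood of \<open>t\<close> serves all test fields: continuity of
    \<open>P\<close> and \<open>Q\<close> makes \<open>F s\<close> close to \<open>F t\<close>
    relative to \<open>N\<close>.\<close>
  have test: "\<forall>\<^sub>F s in at t. s \<in> {a<..<b} \<and> s \<noteq> t \<and> (\<forall>\<phi>\<in>trig_field L int_freqs.
      \<bar>L2_inner L (A s) \<phi> - L2_inner L (A t) \<phi> - (s - t) * F t \<phi> (curl \<phi>)\<bar> \<le> e * N \<phi> (curl \<phi>) * \<bar>s - t\<bar>)"
    if e: "e > 0" for e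
  proof -
    have "\<forall>\<^sub>F s in at t. s \<in> {a<..<b} \<and> L2_norm L (\<lambda>x. P s x - P t x) < e \<and> L2_norm L (\<lambda>x. Q s x - Q t x) < e"
      using eventually_Ioo[OF t] order_tendstoD(2)[OF P(2)[unfolded L2_cont_def] e]
        order_tendstoD(2)[OF Q(2)[unfolded L2_cont_def] e]
      by eventually_elim auto
    then obtain d where d: "d > 0" and close: "\<And>s. s \<noteq> t \<Longrightarrow> dist s t < d \<Longrightarrow> s \<in> {a<..<b} \<and>
        L2_norm L (\<lambda>x. P s x - P t x) < e \<and> L2_norm L (\<lambda>x. Q s x - Q t x) < e"
      unfolding eventually_at by auto
    have in_I: "s \<in> {a<..<b}" and PQ: "L2_norm L (\<lambda>x. P s x - P t x) \<le> e" "L2_norm L (\<lambda>x. Q s x - Q t x) \<le> e"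
      if "s \<in> ball t d" for s
      using close[of s] that t e by (cases "s = t"; force simp: dist_commute less_imp_le)+
    have "\<bar>L2_inner L (A s) \<phi> - L2_inner L (A t) \<phi> - (s - t) * F t \<phi> (curl \<phi>)\<bar> \<le> e * N \<phi> (curl \<phi>) * \<bar>s - t\<bar>"
      if s: "s \<in> ball t d" and \<phi>: "\<phi> \<in> trig_field L int_freqs" for s \<phi>
    proof -
      have L\<phi>: "L2_field L \<phi>" "L2_field L (curl \<phi>)"
        using trig_field_L2[OF \<phi>] trig_field_L2[OF curl_trig_field[OF L subset_refl \<phi>]] by auto
      have \<phi>': "\<phi> \<in> periodic_test L" by (rule trig_field_periodic_test[OF L subset_refl \<phi>])
      \<comment> \<open>Subtracting the linear part with slope \<open>F t\<close> leaves a function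
        of small derivative, to which the mean value bound applies.\<close>
      let ?f = "\<lambda>r. L2_inner L (A r) \<phi> - r * F t \<phi> (curl \<phi>)"
      have "norm (?f s - ?f t) \<le> (e * N \<phi> (curl \<phi>)) * norm (s - t)"
      proof (rule field_differentiable_bound[where S = "ball t d"
            and f' = "\<lambda>r. F r \<phi> (curl \<phi>) - F t \<phi> (curl \<phi>)"])
        fix r assume r: "r \<in> ball t d"
        have "((\<lambda>r. L2_inner L (A r) \<phi>) has_real_derivative F r \<phi> (curl \<phi>)) (at r)"
          using D[OF in_I[OF r] \<phi>'] by (simp add: F_def)
        from DERIV_diff[OF this DERIV_cmult_right[OF DERIV_ident, of "F t \<phi> (curl \<phi>)"]]
        have "(?f has_field_derivative F r \<phi> (curl \<phi>) - F t \<phi> (curl \<phi>)) (at r)" by simp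
        then show "(?f has_field_derivative F r \<phi> (curl \<phi>) - F t \<phi> (curl \<phi>)) (at r within ball t d)"
          by (rule has_field_derivative_at_within)
        have p: "\<bar>L2_inner L \<phi> (P r) - L2_inner L \<phi> (P t)\<bar> \<le> L2_norm L \<phi> * e"
          by (rule L2_inner_diff_bound[OF L\<phi>(1) P(1)[OF in_I[OF r]] P(1)[OF t] PQ(1)[OF r]])
        have q: "\<bar>L2_inner L (curl \<phi>) (Q r) - L2_inner L (curl \<phi>) (Q t)\<bar> \<le> L2_norm L (curl \<phi>) * e"
          by (rule L2_inner_diff_bound[OF L\<phi>(2) Q(1)[OF in_I[OF r]] Q(1)[OF t] PQ(2)[OF r]])
        have "\<bar>F r \<phi> (curl \<phi>) - F t \<phi> (curl \<phi>)\<bar> \<le> L2_norm L \<phi> * e + L2_norm L (curl \<phi>) * e"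
          using p q unfolding F_def L2_inner_commute[of L \<phi>] L2_inner_commute[of L "curl \<phi>"] by linarith
        then show "norm (F r \<phi> (curl \<phi>) - F t \<phi> (curl \<phi>)) \<le> e * N \<phi> (curl \<phi>)"
          by (simp add: N_def algebra_simps)
      qed (use s d in auto)
      moreover have "?f s - ?f t = L2_inner L (A s) \<phi> - L2_inner L (A t) \<phi> - (s - t) * F t \<phi> (curl \<phi>)"
        by (simp add: algebra_simps)
      ultimately show ?thesis by simp
    qed
    then have "\<forall>s. s \<noteq> t \<and> dist s t < d \<longrightarrow> s \<in> {a<..<b} \<and> s \<noteq> t \<and> (\<forall>\<phi>\<in>trig_field L int_freqs.
        \<bar>L2_inner L (A s) \<phi> - L2_inner L (A t) \<phi> - (s - t) * F t \<phi> (curl \<phi>)\<bar> \<le> e * N \<phi> (curl \<phi>) * \<bar>s - t\<bar>)"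
      using in_I by (simp add: dist_commute)
    then show ?thesis
      unfolding eventually_at using d by auto
  qed
  \<comment> \<open>For fixed \<open>s\<close> both sides are continuous in the curl norm, so the
    estimate passes to limits of test fields.\<close>
  have dense: "\<bar>L2_inner L (A s) g - L2_inner L (A t) g - (s - t) * F t g (wcurl L g)\<bar>
      \<le> e * N g (wcurl L g) * \<bar>s - t\<bar>"
    if s: "s \<in> {a<..<b}" and e: "e > 0" and g: "g \<in> Hcurl_per L"
      and *: "\<And>\<phi>. \<phi> \<in> trig_field L int_freqs \<Longrightarrow>
      \<bar>L2_inner L (A s) \<phi> - L2_inner L (A t) \<phi> - (s - t) * F t \<phi> (curl \<phi>)\<bar> \<le> e * N \<phi> (curl \<phi>) * \<bar>s - t\<bar>"
    for s e g
  proof (rule le_of_le_add_mult_eps)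
    \<comment> \<open>The summands are the costs of replacing \<open>g\<close> by \<open>p\<close>
      in the pairings with \<open>A s\<close> and \<open>A t\<close>, in \<open>F t\<close>, and in
      \<open>N\<close>, which grows by at most 2 \<eta>.\<close>
    let ?C = "L2_norm L (A s) + L2_norm L (A t) + \<bar>s - t\<bar> * N (P t) (Q t) + e * 2 * \<bar>s - t\<bar>"
    show "?C \<ge> 0" using e by (simp add: N_def)
    fix \<eta> :: real assume "\<eta> > 0"
    then obtain p where p: "p \<in> trig_field L int_freqs" "L2_norm L (\<lambda>x. g x - p x) < \<eta>"
      "L2_norm L (\<lambda>x. wcurl L g x - curl p x) < \<eta>"
      by (rule Hcurl_per_dense[OF L g])
    have Lp: "L2_field L p" "L2_field L (curl p)"
      using trig_field_L2[OF p(1)] trig_field_L2[OF curl_trig_field[OF L subset_refl p(1)]] by auto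
    note Lg = Hcurl_per_L2[OF g]
    have s1: "\<bar>L2_inner L (A s) g - L2_inner L (A s) p\<bar> \<le> L2_norm L (A s) * \<eta>"
      by (rule L2_inner_diff_bound[OF LA(1)[OF s] Lg(1) Lp(1) less_imp_le[OF p(2)]])
    have s2: "\<bar>L2_inner L (A t) g - L2_inner L (A t) p\<bar> \<le> L2_norm L (A t) * \<eta>"
      by (rule L2_inner_diff_bound[OF LA(1)[OF t] Lg(1) Lp(1) less_imp_le[OF p(2)]])
    have s3: "\<bar>L2_inner L (P t) g - L2_inner L (P t) p\<bar> \<le> L2_norm L (P t) * \<eta>"
      by (rule L2_inner_diff_bound[OF P(1)[OF t] Lg(1) Lp(1) less_imp_le[OF p(2)]])
    have s4: "\<bar>L2_inner L (Q t) (wcurl L g) - L2_inner L (Q t) (curl p)\<bar> \<le> L2_norm L (Q t) * \<eta>"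
      by (rule L2_inner_diff_bound[OF Q(1)[OF t] Lg(2) Lp(2) less_imp_le[OF p(3)]])
    have "\<bar>F t g (wcurl L g) - F t p (curl p)\<bar> \<le> N (P t) (Q t) * \<eta>"
      using s3 s4 unfolding F_def N_def distrib_right by linarith
    then have s5: "\<bar>(s - t) * F t g (wcurl L g) - (s - t) * F t p (curl p)\<bar> \<le> \<bar>s - t\<bar> * (N (P t) (Q t) * \<eta>)"
      unfolding right_diff_distrib[symmetric] abs_mult by (intro mult_left_mono) auto
    have "L2_norm L p \<le> L2_norm L g + \<eta>" "L2_norm L (curl p) \<le> L2_norm L (wcurl L g) + \<eta>"
      using L2_norm_triangle[OF L2_field_diff[OF Lp(1) Lg(1)] Lg(1)]
        L2_norm_triangle[OF L2_field_diff[OF Lp(2) Lg(2)] Lg(2)] p(2,3)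
      by (simp_all add: L2_norm_minus_commute[of L p] L2_norm_minus_commute[of L "curl p"])
    then have "e * N p (curl p) * \<bar>s - t\<bar> \<le> e * (N g (wcurl L g) + 2 * \<eta>) * \<bar>s - t\<bar>"
      using e by (intro mult_right_mono mult_left_mono) (auto simp: N_def)
    moreover have "?C * \<eta> = L2_norm L (A s) * \<eta> + L2_norm L (A t) * \<eta> + \<bar>s - t\<bar> * (N (P t) (Q t) * \<eta>)
        + (e * (N g (wcurl L g) + 2 * \<eta>) * \<bar>s - t\<bar> - e * N g (wcurl L g) * \<bar>s - t\<bar>)"
      by (simp add: algebra_simps)
    ultimately show "\<bar>L2_inner L (A s) g - L2_inner L (A t) g - (s - t) * F t g (wcurl L g)\<bar>
        \<le> e * N g (wcurl L g) * \<bar>s - t\<bar> + ?C * \<eta>"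
      using *[OF p(1)] s1 s2 s5 by linarith
  qed
  let ?F = "\<lambda>s. F t (A s) (wcurl L (A s))" and ?N = "\<lambda>s. N (A s) (wcurl L (A s))"
  let ?q = "\<lambda>s. ((L2_norm L (A s))\<^sup>2 - (L2_norm L (A t))\<^sup>2) / (s - t)"
  have F_lim: "(?F \<longlongrightarrow> ?F t) (at t)"
    unfolding F_def
    by (intro tendsto_add L2_cont_inner[OF t LA(1) A(2) P(1)[OF t]] L2_cont_inner[OF t LA(2) A(3) Q(1)[OF t]])
  have N_lim: "(?N \<longlongrightarrow> ?N t) (at t)"
    unfolding N_def by (intro tendsto_add L2_cont_norm[OF t LA(1) A(2)] L2_cont_norm[OF t LA(2) A(3)])
  have "((\<lambda>s. ?q s - (?F s + ?F t)) \<longlongrightarrow> 0) (at t)"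
  proof (rule tendstoI)
    fix \<epsilon> :: real assume \<epsilon>: "\<epsilon> > 0"
    \<comment> \<open>Near \<open>t\<close> the sum \<open>?N s + ?N t\<close> is below the
      denominator, which turns the relative error \<open>e\<close> into \<epsilon>.\<close>
    define e where "e = \<epsilon> / (2 * ?N t + 1)"
    have N0: "?N t \<ge> 0" by (simp add: N_def)
    have e: "e > 0" using \<epsilon> N0 by (simp add: e_def add_nonneg_pos)
    have "\<forall>\<^sub>F s in at t. ?N s < ?N t + 1"
      by (rule order_tendstoD(2)[OF N_lim]) simp
    with test[OF e] show "\<forall>\<^sub>F s in at t. dist (?q s - (?F s + ?F t)) 0 < \<epsilon>"
    proof eventually_elim
      case (elim s)
      then have s: "s \<in> {a<..<b}" "s \<noteq> t" and *: "\<And>\<phi>. \<phi> \<in> trig_field L int_freqs \<Longrightarrow>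
        \<bar>L2_inner L (A s) \<phi> - L2_inner L (A t) \<phi> - (s - t) * F t \<phi> (curl \<phi>)\<bar> \<le> e * N \<phi> (curl \<phi>) * \<bar>s - t\<bar>"
        by auto
      \<comment> \<open>The increment of \<open>A\<close> is tested with \<open>A s\<close> and with
        \<open>A t\<close>; the mixed inner products cancel by symmetry.\<close>
      have "\<bar>(L2_norm L (A s))\<^sup>2 - (L2_norm L (A t))\<^sup>2 - (s - t) * (?F s + ?F t)\<bar>
          \<le> e * (?N s + ?N t) * \<bar>s - t\<bar>"
        using dense[OF s(1) e A(1)[OF s(1)] *] dense[OF s(1) e A(1)[OF t] *]
        unfolding L2_norm_sq L2_inner_commute[of L "A t" "A s"] distrib_left distrib_right by linarith
      also have "\<dots> < \<epsilon> * \<bar>s - t\<bar>"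
      proof (rule mult_strict_right_mono)
        have "e * (?N s + ?N t) < e * (2 * ?N t + 1)"
          using elim(2) e by (intro mult_strict_left_mono) auto
        also have "\<dots> = \<epsilon>" using N0 by (simp add: e_def)
        finally show "e * (?N s + ?N t) < \<epsilon>" .
      qed (use s in simp)
      also have "(L2_norm L (A s))\<^sup>2 - (L2_norm L (A t))\<^sup>2 - (s - t) * (?F s + ?F t)
          = (?q s - (?F s + ?F t)) * (s - t)"
        using s(2) by (simp only: left_diff_distrib[of "?q s"]) simp
      finally have "\<bar>(?q s - (?F s + ?F t)) * (s - t)\<bar> < \<epsilon> * \<bar>s - t\<bar>" .
      then show ?case
        using s(2) by (simp add: abs_mult)
    qed
  qed
  from tendsto_add[OF this tendsto_add[OF F_lim tendsto_const[of "?F t"]]]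
  show ?thesis
    by (simp add: has_field_derivative_iff F_def)
qed

theorem theorem2:
  fixes L T \<epsilon>0 \<mu>0 \<omega>pe \<omega>pm c :: real
    and H Ht J Jt :: "real \<Rightarrow> real^3 \<Rightarrow> real^3"
  assumes "L > 0" and "T > 0"
    and "\<epsilon>0 > 0" and "\<mu>0 > 0" and "\<omega>pe > 0" and "\<omega>pm > 0"
    and "c = 1 / sqrt (\<epsilon>0 * \<mu>0)"
    and "C1_Hcurl_per L T H Ht"
    and "C1_Hcurl_per L T J Jt"
    and "drude_solution L T c \<omega>pe \<omega>pm H Ht J Jt"
  shows "\<forall>t\<in>{0<..<T}. ((\<lambda>s. energy_HJ L c \<omega>pe \<omega>pm H Ht J Jt s) has_real_derivative 0) (at t)"
proof
  fix t assume t: "t \<in> {0<..<T}"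
  note L = assms(1)
  note H = C1_Hcurl_perD[OF L assms(8)] and J = C1_Hcurl_perD[OF L assms(9)]
  have c: "c > 0" using assms(3,4,7) by simp
  let ?K = "\<lambda>s. wcurl L (H s)" and ?Kt = "wcurl L (Ht t)"
  note L2 = Hcurl_per_L2[OF H(1)] Hcurl_per_L2[OF H(2)] Hcurl_per_L2[OF J(1)] Hcurl_per_L2[OF J(2)]
  have cont: "L2_cont L H t" "L2_cont L ?K t" "L2_cont L J t" "L2_cont L (\<lambda>s. wcurl L (J s)) t"
    using L2_deriv_imp_cont[OF t L2(1) L2(3)[OF t] H(3)[OF t]] L2_deriv_imp_cont[OF t L2(2) L2(4)[OF t] H(4)[OF t]]
      L2_deriv_imp_cont[OF t L2(5) L2(7)[OF t] J(3)[OF t]] L2_deriv_imp_cont[OF t L2(6) L2(8)[OF t] J(4)[OF t]]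
    by blast+

  have dH: "((\<lambda>s. (L2_norm L (H s))\<^sup>2) has_real_derivative 2 * L2_inner L (Ht t) (H t)) (at t)"
    by (rule L2_norm_sq_has_derivative[OF t L2(1) L2(3)[OF t] H(3)[OF t]])
  have dK: "((\<lambda>s. (L2_norm L (\<lambda>x. ?K s x - J s x))\<^sup>2) has_real_derivative
      2 * L2_inner L (\<lambda>x. ?Kt x - Jt t x) (\<lambda>x. ?K t x - J t x)) (at t)"
  proof (rule L2_norm_sq_has_derivative[OF t])
    show "L2_deriv L (\<lambda>s x. ?K s x - J s x) (\<lambda>x. ?Kt x - Jt t x) t"
      by (rule L2_deriv_diff[OF t L2(2) L2(4)[OF t] H(4)[OF t] L2(5) L2(7)[OF t] J(3)[OF t]])
  qed (use L2 t in auto)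

  \<comment> \<open>Weak form of the first equation: the second derivative of \<open>H\<close> pairs
    \<open>?P\<close> with the test field and \<open>?Q\<close> with its curl, the latter coming
    from curl curl \<open>H\<close>. The zero summand gives \<open>?Q\<close> the shape that
    \<open>L2_cont_lincomb\<close> expects.\<close>
  let ?P = "\<lambda>s x. c\<^sup>2 *\<^sub>R wcurl L (J s) x + (- \<omega>pm\<^sup>2) *\<^sub>R H s x"
  let ?Q = "\<lambda>s x. (- c\<^sup>2) *\<^sub>R ?K s x + 0 *\<^sub>R H s x"
  have dHt: "((\<lambda>s. (L2_norm L (Ht s))\<^sup>2) has_real_derivative
      2 * (L2_inner L (?P t) (Ht t) + L2_inner L (?Q t) (wcurl L (Ht t)))) (at t)"
  proof (rule L2_norm_sq_has_derivative_dual[OF L t H(2) H(5)[OF t] H(6)[OF t]])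
    show "L2_cont L ?P t"
      by (rule L2_cont_lincomb[OF t L2(6) cont(4) L2(1) cont(1)])
    show "L2_cont L ?Q t"
      by (rule L2_cont_lincomb[OF t L2(2) cont(2) L2(1) cont(1)])
    fix s \<phi> assume s: "s \<in> {0<..<T}" and \<phi>: "\<phi> \<in> periodic_test L"
    obtain Htt where 1: "((\<lambda>r. dist_of L (Ht r) \<phi>) has_real_derivative Htt \<phi>) (at s)"
      and 2: "Htt \<phi> + c\<^sup>2 * dist_curl (dist_of L (?K s)) \<phi> + \<omega>pm\<^sup>2 * dist_of L (H s) \<phi>
             = c\<^sup>2 * dist_of L (wcurl L (J s)) \<phi>"
      using assms(10) s \<phi> unfolding drude_solution_def has_dist_derivative_def by blast
    have "L2_field L \<phi>" "L2_field L (curl \<phi>)"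
      using \<phi> by (auto simp: periodic_test_def intro!: L2_field_continuous smooth_field_continuous continuous_curl)
    then have "L2_inner L (?P s) \<phi> + L2_inner L (?Q s) (curl \<phi>) = Htt \<phi>"
      using 2 L2[OF s] unfolding dist_curl_def dist_of_def
      by (simp add: L2_inner_add_left L2_inner_scaleR_left del: scaleR_minus_left scaleR_zero_left)
    with 1 show "((\<lambda>r. L2_inner L (Ht r) \<phi>) has_real_derivative
        L2_inner L (?P s) \<phi> + L2_inner L (?Q s) (curl \<phi>)) (at s)"
      by (simp add: dist_of_def)
  qed (assumption | intro L2_field_add L2_field_scaleR L2)+

  \<comment> \<open>In the second equation curl \<open>H\<close> is already a square integrable
    field, so nothing is paired with the curl of the test field.\<close>
  let ?P' = "\<lambda>s x. \<omega>pe\<^sup>2 *\<^sub>R ?K s x + (- \<omega>pe\<^sup>2) *\<^sub>R J s x"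
  have dJt: "((\<lambda>s. (L2_norm L (Jt s))\<^sup>2) has_real_derivative
      2 * (L2_inner L (?P' t) (Jt t) + L2_inner L (\<lambda>x. 0) (wcurl L (Jt t)))) (at t)"
  proof (rule L2_norm_sq_has_derivative_dual[OF L t J(2) J(5)[OF t] J(6)[OF t]])
    show "L2_cont L ?P' t"
      by (rule L2_cont_lincomb[OF t L2(2) cont(2) L2(5) cont(3)])
    fix s \<phi> assume s: "s \<in> {0<..<T}" and \<phi>: "\<phi> \<in> periodic_test L"
    obtain Jtt where 1: "((\<lambda>r. dist_of L (Jt r) \<phi>) has_real_derivative Jtt \<phi>) (at s)"
      and 2: "Jtt \<phi> + \<omega>pe\<^sup>2 * dist_of L (J s) \<phi> = \<omega>pe\<^sup>2 * dist_of L (?K s) \<phi>"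
      using assms(10) s \<phi> unfolding drude_solution_def has_dist_derivative_def by blast
    have "L2_field L \<phi>"
      using \<phi> by (auto simp: periodic_test_def intro!: L2_field_continuous smooth_field_continuous)
    then have "L2_inner L (?P' s) \<phi> + L2_inner L (\<lambda>x. 0) (curl \<phi>) = Jtt \<phi>"
      using 2 L2[OF s] unfolding dist_of_def
      by (simp add: L2_inner_add_left L2_inner_scaleR_left del: scaleR_minus_left)
    with 1 show "((\<lambda>r. L2_inner L (Jt r) \<phi>) has_real_derivative
        L2_inner L (?P' s) \<phi> + L2_inner L (\<lambda>x. 0) (curl \<phi>)) (at s)"
      by (simp add: dist_of_def)
  qed (assumption | intro L2_field_add L2_field_scaleR L2_field_zero L2 | simp add: L2_cont_def)+

  let ?E' = "1 / 2 * (1 / c\<^sup>2 * (2 * (L2_inner L (?P t) (Ht t) + L2_inner L (?Q t) ?Kt))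
      + 1 / \<omega>pe\<^sup>2 * (2 * (L2_inner L (?P' t) (Jt t) + L2_inner L (\<lambda>x. 0) (wcurl L (Jt t))))
      + \<omega>pm\<^sup>2 / c\<^sup>2 * (2 * L2_inner L (Ht t) (H t))
      + 2 * L2_inner L (\<lambda>x. ?Kt x - Jt t x) (\<lambda>x. ?K t x - J t x))"
  have "((\<lambda>s. energy_HJ L c \<omega>pe \<omega>pm H Ht J Jt s) has_real_derivative ?E') (at t)"
    unfolding energy_HJ_def by (intro DERIV_add DERIV_cmult dH dK dHt dJt)
  moreover have "?E' = 0"
  proof -
    note L2t = L2[OF t]
    \<comment> \<open>The weights of the energy divide out \<open>c^2\<close> and
      \<open>\<omega>pe^2\<close>, so that the pairings below match those from the mixed term
      \<open>K\<close>; the pairing of \<open>H\<close> with \<open>Ht\<close> meets the derivative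
      of its own energy term.\<close>
    have P: "L2_inner L (?P t) (Ht t) = c\<^sup>2 * L2_inner L (wcurl L (J t)) (Ht t) - \<omega>pm\<^sup>2 * L2_inner L (H t) (Ht t)"
      and Q: "L2_inner L (?Q t) ?Kt = - c\<^sup>2 * L2_inner L (?K t) ?Kt"
      and P': "L2_inner L (?P' t) (Jt t) = \<omega>pe\<^sup>2 * (L2_inner L (?K t) (Jt t) - L2_inner L (J t) (Jt t))"
      using L2t by (simp_all add: L2_inner_add_left L2_inner_scaleR_left right_diff_distrib
          del: scaleR_minus_left scaleR_zero_left)
    have K: "L2_inner L (\<lambda>x. ?Kt x - Jt t x) (\<lambda>x. ?K t x - J t x)
        = L2_inner L (?K t) ?Kt - L2_inner L (J t) ?Kt - L2_inner L (?K t) (Jt t) + L2_inner L (J t) (Jt t)"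
      using L2t by (simp add: L2_inner_diff_left L2_inner_diff_right L2_inner_commute[of L "?Kt"]
          L2_inner_commute[of L "Jt t"])
    have G: "L2_inner L (wcurl L (J t)) (Ht t) = L2_inner L (J t) ?Kt"
      by (rule Hcurl_per_Green[OF L J(1)[OF t] H(2)[OF t]])
    show ?thesis
      unfolding P Q P' K G L2_inner_commute[of L "Ht t" "H t"]
      using c assms(5) by (simp add: field_simps)
  qed
  ultimately show "((\<lambda>s. energy_HJ L c \<omega>pe \<omega>pm H Ht J Jt s) has_real_derivative 0) (at t)"
    by simp
qed

end
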